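(* Fix a coarse interval $(t_i,t_{i+1}]$ and a realised grid past $\mathbf z_i$. Let the one-step reference $R_i^{\mathbf z_i}$ (a probability law of pairs $(\eta,\xi)$, where $\eta$ is a $Y$-path and $\xi$ an $X$-path on the interval) be triangular, i.e. $$R_i^{\mathbf z_i}(d\eta,d\xi)=R_{Y,i}^{\mathbf z_i}(d\eta)\,R_{X,i}^{\mathbf z_i,\eta_{t_{i+1}}}(d\xi),$$ so that the conditional reference law of the $X$-path given the $Y$-path depends on $\eta$ only through its endpoint $\eta_{t_{i+1}}$. Let $\mu_i^{\mathbf z_i}(dy_{i+1},dx_{i+1})$ be a target law for $(Y_{t_{i+1}},X_{t_{i+1}})$, disintegrated as $\mu_i^{\mathbf z_i}(dy_{i+1},dx_{i+1})=\mu_{Y,i}^{\mathbf z_i}(dy_{i+1})\,\mu_{X,i}^{\mathbf z_i,y_{i+1}}(dx_{i+1})$, and assume $\mu_i^{\mathbf z_i}\ll r_i^{\mathbf z_i}$ and $H(\mu_i^{\mathbf z_i}\mid r_i^{\mathbf z_i})<\infty$, where $r_i^{\mathbf z_i}:=R_i^{\mathbf z_i}\circ(Y_{t_{i+1}},X_{t_{i+1}})^{-1}$. Let $Q$ be a probability law on the same path space with $Q\circ(Y_{t_{i+1}},X_{t_{i+1}})^{-1}=\mu_i^{\mathbf z_i}$. Then $Q$ minimises $H(\cdot\mid R_i^{\mathbf z_i})$ among all such laws if and only if: (i) its $Y$-marginal $Q_Y$ minimises $\inf\{H(M\mid R_{Y,i}^{\mathbf z_i}):\ M\circ Y_{t_{i+1}}^{-1}=\mu_{Y,i}^{\mathbf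 z_i}\}$; and (ii) disintegrating $Q(d\eta,d\xi)=Q_Y(d\eta)\,Q_X^\eta(d\xi)$, one has for $Q_Y$-a.e. $\eta$, with $y_{i+1}=\eta_{t_{i+1}}$, $$Q_X^\eta=Q_{X,i}^{\star,\mathbf z_i,y_{i+1}},$$ where $Q_{X,i}^{\star,\mathbf z_i,y_{i+1}}$ is the unique minimiser of $\inf\{H(N\mid R_{X,i}^{\mathbf z_i,y_{i+1}}):\ N\circ X_{t_{i+1}}^{-1}=\mu_{X,i}^{\mathbf z_i,y_{i+1}}\}$.
   Context: $H(P\mid R)=E_P[\log(dP/dR)]$ if $P\ll R$, $+\infty$ otherwise, is relative entropy. The state is $Z=(X,Y)$, with $X$ and $Y$ taking values in Euclidean spaces; paths on the interval are continuous; $\mathbf z_i$ is a fixed value of the grid past $(Z_{t_0},\dots,Z_{t_i})$ and enters only as a fixed parameter. All laws are Borel probability measures on the relevant (standard Borel) path spaces. *)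

theory Defs
  imports "HOL-Probability.Probability"
begin

text \<open>
  Continuous paths on \<open>I\<close>, taken extensional so that equality of paths is equality on \<open>I\<close>.
\<close>

definition paths :: "real set \<Rightarrow> (real \<Rightarrow> 'a::euclidean_space) set" where
  "paths I = {f \<in> extensional I. continuous_on I f}"

text \<open>
  The compact-open topology, that is, locally uniform convergence on \<open>I\<close>; for compact \<open>I\<close> it is the
  topology of the supremum norm. For an interval \<open>I\<close> it is Polish, so its Borel space is standard.
\<close>

definition path_topology :: "real set \<Rightarrow> (real \<Rightarrow> 'a::euclidean_space) topology" where
  "path_topology I =
     topology_generated_by {{f \<in> paths I. f ` K \<subseteq> U} | K U. compact K \<and> K \<subseteq> I \<and> open U}"

definition path_borel :: "real set \<Rightarrow> (real \<Rightarrow> 'a::euclidean_space) measure" where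
  "path_borel I = sigma (topspace (path_topology I)) {U. openin (path_topology I) U}"

text \<open>
  For probability measures with \<open>P \<ll> R\<close> the negative part of \<open>log (dP/dR)\<close> is always
  \<open>P\<close>-integrable, because \<open>u log u\<close> is bounded below. Hence its expectation under \<open>P\<close> is
  \<open>+\<infinity>\<close> exactly when integrability fails. That case has to be treated separately, since the
  Bochner integral in \<^const>\<open>KL_divergence\<close> is then 0. Note that \<^const>\<open>KL_divergence\<close>
  takes the reference measure first.
\<close>

definition relative_entropy :: "'a measure \<Rightarrow> 'a measure \<Rightarrow> ereal" where
  "relative_entropy P R =
     (if absolutely_continuous R P \<and> integrable P (entropy_density (exp 1) R P)
      then ereal (KL_divergence (exp 1) R P) else \<infinity>)"

text \<open>The measure \<open>\<mu>(dx) K(x, dy)\<close>, where \<open>N\<close> carries the \<open>\<sigma>\<close>-algebra for \<open>y\<close>.\<close>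

definition kernel_product :: "'a measure \<Rightarrow> 'b measure \<Rightarrow> ('a \<Rightarrow> 'b measure) \<Rightarrow> ('a \<times> 'b) measure" where
  "kernel_product \<mu> N K = \<mu> \<bind> (\<lambda>x. K x \<bind> (\<lambda>y. return (\<mu> \<Otimes>\<^sub>M N) (x, y)))"

definition is_disintegration ::
    "'a measure \<Rightarrow> 'b measure \<Rightarrow> ('a \<times> 'b) measure \<Rightarrow> 'a measure \<Rightarrow> ('a \<Rightarrow> 'b measure) \<Rightarrow> bool" where
  "is_disintegration M N Q \<mu> K \<longleftrightarrow>
     \<mu> \<in> space (prob_algebra M) \<and> K \<in> M \<rightarrow>\<^sub>M prob_algebra N \<and> Q = kernel_product \<mu> N K"

text \<open>
  \<open>Q\<close> minimises the entropy relative to \<open>R\<close> among the probability laws on \<open>M\<close> whose image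
  under \<open>e\<close> is \<open>\<nu>\<close>.
\<close>

definition entropy_minimiser ::
    "'a measure \<Rightarrow> ('a \<Rightarrow> 'b::topological_space) \<Rightarrow> 'a measure \<Rightarrow> 'b measure \<Rightarrow> 'a measure \<Rightarrow> bool" where
  "entropy_minimiser M e R \<nu> Q \<longleftrightarrow>
     is_arg_min (\<lambda>P. relative_entropy P R) (\<lambda>P. P \<in> space (prob_algebra M) \<and> distr P borel e = \<nu>) Q"

definition endpoints :: "real \<Rightarrow> (real \<Rightarrow> 'y) \<times> (real \<Rightarrow> 'x) \<Rightarrow> 'y \<times> 'x" where
  "endpoints t = (\<lambda>(\<eta>, \<xi>). (\<eta> t, \<xi> t))"

end

theory Submission
  imports Defs
begin

text \<open>
  If a law \<open>\<nu>\<close> has density \<open>f\<close> and finite entropy relative to the image of \<open>R\<close> under an endpoint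
  map \<open>e\<close>, then by Gibbs' inequality the only entropy minimiser relative to \<open>R\<close> with image \<open>\<nu>\<close> is
  the measure with density \<open>f \<circ> e\<close> with respect to \<open>R\<close>. All three minimisation problems are of this
  form, so everything reduces to disintegrating an explicit density. Write
  \<open>f (y, x) = c y * (f (y, x) / c y)\<close>, where \<open>c y\<close> is the integral of \<open>f (y, \<cdot>)\<close> against the endpoint law
  of \<open>RX y\<close>. By triangularity of \<open>R\<close> the joint minimiser disintegrates into the measure with density
  \<open>c (\<eta> t)\<close> with respect to \<open>RY\<close>, which is the minimiser for the \<open>Y\<close>-problem, and the kernel with
  density \<open>f (\<eta> t, \<xi> t) / c (\<eta> t)\<close> with respect to \<open>RX (\<eta> t)\<close>, which consists of the minimisers for
  the \<open>X\<close>-problems. Almost sure uniqueness of disintegrations, which holds because the path space is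
  countably generated, gives the equivalence.
\<close>

section \<open>Entropy minimisation under an endpoint constraint\<close>

lemma AE_density_pos_finite:
  assumes g: "g \<in> borel_measurable R" and P: "prob_space (density R g)"
  shows "AE x in density R g. 0 < g x \<and> g x < \<infinity>"
proof -
  have "(\<integral>\<^sup>+x. g x \<partial>R) = 1"
    using prob_space.emeasure_space_1[OF P] g by (simp add: emeasure_density cong: nn_integral_cong)
  then have "AE x in R. g x \<noteq> \<infinity>"
    using g by (intro nn_integral_PInf_AE) auto
  then show ?thesis
    using g by (auto simp: AE_density less_top)
qed

text \<open>Uniqueness of the Radon-Nikodym derivative replaces \<open>RN_deriv\<close> by
  \<open>g\<close> almost everywhere. Later arguments can therefore use whichever density is at
  hand.\<close>

lemma relative_entropy_density:
  assumes R: "prob_space R" and g: "g \<in> borel_measurable R"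
  shows "relative_entropy (density R g) R =
    (if integrable (density R g) (\<lambda>x. ln (enn2real (g x)))
     then ereal (\<integral>x. ln (enn2real (g x)) \<partial>density R g) else \<infinity>)"
proof -
  interpret R: prob_space R by fact
  let ?P = "density R g" and ?d = "\<lambda>x. ln (enn2real (RN_deriv R (density R g) x))"
  have ac: "absolutely_continuous R ?P"
    using g by (auto intro: absolutely_continuousI_density)
  have "AE x in R. g x = RN_deriv R ?P x"
    by (rule R.RN_deriv_unique[OF g refl])
  then have *: "AE x in ?P. ln (enn2real (g x)) = ?d x"
    using g by (auto simp: AE_density)
  have d: "entropy_density (exp 1) R ?P = ?d"
    by (auto simp: entropy_density_def log_def)
  have "integrable ?P ?d = integrable ?P (\<lambda>x. ln (enn2real (g x)))"
    using * g by (intro integrable_cong_AE) auto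
  moreover have "(\<integral>x. ?d x \<partial>?P) = (\<integral>x. ln (enn2real (g x)) \<partial>?P)"
    using * g by (intro integral_cong_AE) auto
  ultimately show ?thesis
    by (simp add: relative_entropy_def KL_divergence_def d ac)
qed

section \<open>Gibbs' inequality with its equality case\<close>

lemma (in prob_space) integral_ln_le_0:
  fixes u :: "'a \<Rightarrow> real"
  assumes [measurable]: "u \<in> borel_measurable M" and pos: "AE x in M. 0 < u x"
    and ln: "integrable M (\<lambda>x. ln (u x))" and le: "(\<integral>\<^sup>+x. ennreal (u x) \<partial>M) \<le> 1"
  shows "(\<integral>x. ln (u x) \<partial>M) \<le> 0"
    and "(\<integral>x. ln (u x) \<partial>M) = 0 \<Longrightarrow> AE x in M. u x = 1"
proof -
  have u: "integrable M u"
  proof (rule integrableI_nonneg)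
    show "AE x in M. 0 \<le> u x" using pos by auto
    show "(\<integral>\<^sup>+x. ennreal (u x) \<partial>M) < \<infinity>" using le by (auto intro: le_less_trans)
  qed simp
  have u1: "(\<integral>x. u x \<partial>M) \<le> 1"
    using le u pos by (subst (asm) nn_integral_eq_integral) auto
  \<comment> \<open>The gap in \<open>ln u \<le> u - 1\<close> is nonnegative and vanishes only at
    \<open>u = 1\<close>. Hence a zero integral of the gap settles the equality case.\<close>
  have w: "integrable M (\<lambda>x. u x - 1 - ln (u x))"
    using u ln by auto
  have w_nonneg: "AE x in M. 0 \<le> u x - 1 - ln (u x)"
    using pos by eventually_elim (auto dest: ln_le_minus_one)
  have w_eq: "(\<integral>x. u x - 1 - ln (u x) \<partial>M) = (\<integral>x. u x \<partial>M) - 1 - (\<integral>x. ln (u x) \<partial>M)"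
    using u ln by (simp add: prob_space)
  have w_int: "0 \<le> (\<integral>x. u x - 1 - ln (u x) \<partial>M)"
    using w_nonneg by (rule integral_nonneg_AE)
  then show "(\<integral>x. ln (u x) \<partial>M) \<le> 0"
    using w_eq u1 by linarith
  assume "(\<integral>x. ln (u x) \<partial>M) = 0"
  then have "(\<integral>x. u x - 1 - ln (u x) \<partial>M) = 0"
    using w_eq u1 w_int by linarith
  then have "AE x in M. u x - 1 - ln (u x) = 0"
    using integral_nonneg_eq_0_iff_AE[OF w w_nonneg] by simp
  with pos show "AE x in M. u x = 1"
    by eventually_elim (auto intro: ln_eq_minus_one)
qed

text \<open>Since both total masses are 1, the inequality for the complement of a set is the reverse
  inequality for the set.\<close>

lemma prob_space_eqI_le:
  assumes P: "prob_space P" and Q: "prob_space Q" and s: "sets P = sets Q"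
    and le: "\<And>A. A \<in> sets P \<Longrightarrow> emeasure P A \<le> emeasure Q A"
  shows "P = Q"
proof (rule measure_eqI)
  interpret P: prob_space P by fact
  interpret Q: prob_space Q by fact
  fix A assume A: "A \<in> sets P"
  have sp: "space P = space Q" using s by (rule sets_eq_imp_space_eq)
  have le': "measure P B \<le> measure Q B" if "B \<in> sets P" for B
    using le[OF that] by (simp add: P.emeasure_eq_measure Q.emeasure_eq_measure)
  have "1 - measure P A \<le> 1 - measure Q A"
    using le'[of "space P - A"] A s P.prob_compl[of A] Q.prob_compl[of A] by (simp add: sp)
  with le'[OF A] show "emeasure P A = emeasure Q A"
    by (simp add: P.emeasure_eq_measure Q.emeasure_eq_measure)
qed (fact s)

text \<open>Gibbs' inequality for the quotient \<open>u = h / g\<close>, whose integral under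
  \<open>density R g\<close> is at most the total mass of \<open>density R h\<close>. Positivity of
  \<open>h\<close> makes \<open>ln u\<close> split into a difference of two integrable
  logarithms.\<close>

lemma integral_ln_density_le:
  assumes g[measurable]: "g \<in> borel_measurable R" and h[measurable]: "h \<in> borel_measurable R"
    and P: "prob_space (density R g)" and H: "prob_space (density R h)"
    and pos: "AE x in density R g. 0 < h x \<and> h x < \<infinity>"
    and lg: "integrable (density R g) (\<lambda>x. ln (enn2real (g x)))"
    and lh: "integrable (density R g) (\<lambda>x. ln (enn2real (h x)))"
  shows "(\<integral>x. ln (enn2real (h x)) \<partial>density R g) \<le> (\<integral>x. ln (enn2real (g x)) \<partial>density R g)"
    and "(\<integral>x. ln (enn2real (h x)) \<partial>density R g) = (\<integral>x. ln (enn2real (g x)) \<partial>density R g)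
           \<Longrightarrow> density R g = density R h"
proof -
  let ?P = "density R g"
  interpret P: prob_space ?P by fact
  define u where "u x = enn2real (h x) / enn2real (g x)" for x
  have u_meas: "u \<in> borel_measurable ?P" unfolding u_def by measurable
  have gpos: "AE x in ?P. 0 < g x \<and> g x < \<infinity>"
    by (rule AE_density_pos_finite[OF g P])
  have upos: "AE x in ?P. 0 < u x"
    using gpos pos by eventually_elim (auto simp: u_def enn2real_positive_iff)
  have lnu: "AE x in ?P. ln (u x) = ln (enn2real (h x)) - ln (enn2real (g x))"
    using gpos pos
  proof eventually_elim
    case (elim x)
    then have "0 < enn2real (g x)" "0 < enn2real (h x)" by (auto simp: enn2real_positive_iff)
    then show ?case by (simp add: u_def ln_div)
  qed
  have "integrable ?P (\<lambda>x. ln (u x)) = integrable ?P (\<lambda>x. ln (enn2real (h x)) - ln (enn2real (g x)))"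
    using lnu u_meas by (intro integrable_cong_AE) auto
  then have ilnu: "integrable ?P (\<lambda>x. ln (u x))" using lg lh by simp
  have "(\<integral>x. ln (u x) \<partial>?P) = (\<integral>x. ln (enn2real (h x)) - ln (enn2real (g x)) \<partial>?P)"
    using lnu u_meas by (intro integral_cong_AE) auto
  then have int_lnu: "(\<integral>x. ln (u x) \<partial>?P)
      = (\<integral>x. ln (enn2real (h x)) \<partial>?P) - (\<integral>x. ln (enn2real (g x)) \<partial>?P)"
    using lg lh by simp
  have "(\<integral>\<^sup>+x. ennreal (u x) \<partial>?P) = (\<integral>\<^sup>+x. g x * ennreal (u x) \<partial>R)"
    using u_meas by (subst nn_integral_density) auto
  \<comment> \<open>On \<open>g = 0\<close> the left integrand vanishes while \<open>h\<close> may
    carry mass, so only an inequality holds in general.\<close>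
  also have "\<dots> \<le> (\<integral>\<^sup>+x. h x \<partial>R)"
  proof (rule nn_integral_mono_AE)
    have "AE x in R. 0 < g x \<longrightarrow> (0 < g x \<and> g x < \<infinity>) \<and> (0 < h x \<and> h x < \<infinity>)"
      using gpos pos by (auto simp: AE_density)
    then show "AE x in R. g x * ennreal (u x) \<le> h x"
    proof eventually_elim
      case (elim x)
      show ?case
      proof (cases "g x = 0")
        case False
        with elim obtain a b where "g x = ennreal a" "a > 0" "h x = ennreal b" "b > 0"
          by (cases "g x"; cases "h x") (auto simp: zero_less_iff_neq_zero ennreal_eq_0_iff)
        then show ?thesis by (simp add: u_def ennreal_mult[symmetric])
      qed simp
    qed
  qed
  also have "\<dots> = 1"
    using prob_space.emeasure_space_1[OF H] by (simp add: emeasure_density cong: nn_integral_cong)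
  finally have le1: "(\<integral>\<^sup>+x. ennreal (u x) \<partial>?P) \<le> 1" .
  note gibbs = P.integral_ln_le_0[OF u_meas upos ilnu le1]
  show "(\<integral>x. ln (enn2real (h x)) \<partial>?P) \<le> (\<integral>x. ln (enn2real (g x)) \<partial>?P)"
    using gibbs(1) int_lnu by simp
  assume "(\<integral>x. ln (enn2real (h x)) \<partial>?P) = (\<integral>x. ln (enn2real (g x)) \<partial>?P)"
  then have "AE x in ?P. u x = 1"
    using gibbs(2) int_lnu by simp
  then have "AE x in ?P. g x = h x"
    using gpos pos
  proof eventually_elim
    case (elim x)
    then obtain a b where "g x = ennreal a" "a > 0" "h x = ennreal b" "b > 0"
      by (cases "g x"; cases "h x") (auto simp: zero_less_iff_neq_zero ennreal_eq_0_iff)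
    with elim show ?case by (simp add: u_def)
  qed
  \<comment> \<open>Where \<open>g = 0\<close> nothing is known about \<open>h\<close> beyond
    nonnegativity. The resulting one-sided bound becomes an equality of measures because both are
    probability measures.\<close>
  then have gh: "AE x in R. g x \<le> h x"
    by (auto simp: AE_density zero_less_iff_neq_zero elim!: eventually_mono)
  show "density R g = density R h"
  proof (rule prob_space_eqI_le[OF P H])
    fix A assume "A \<in> sets (density R g)"
    then have [measurable]: "A \<in> sets R" by simp
    have "(\<integral>\<^sup>+x. g x * indicator A x \<partial>R) \<le> (\<integral>\<^sup>+x. h x * indicator A x \<partial>R)"
      using gh by (intro nn_integral_mono_AE) (auto elim!: eventually_mono intro: mult_right_mono)
    then show "emeasure (density R g) A \<le> emeasure (density R h) A"
      by (simp add: emeasure_density)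
  qed simp
qed

text \<open>The integral of \<open>ln (f \<circ> e)\<close> under a competitor depends only on its
  image under \<open>e\<close>, so it is the same constant for all competitors. Gibbs' inequality
  with \<open>h = f \<circ> e\<close> makes this constant a lower bound for the entropy, attained
  only by \<open>density R (f \<circ> e)\<close>.\<close>

lemma entropy_minimiser_iff_density:
  fixes e :: "'a \<Rightarrow> 'b::topological_space"
  assumes R: "R \<in> space (prob_algebra M)" and e: "e \<in> M \<rightarrow>\<^sub>M borel"
    and f: "f \<in> borel_measurable borel"
    and \<nu>: "\<nu> = density (distr R borel e) f" and \<nu>1: "prob_space \<nu>"
    and fin: "integrable \<nu> (\<lambda>y. ln (enn2real (f y)))"
  shows "entropy_minimiser M e R \<nu> Q \<longleftrightarrow> Q = density R (\<lambda>x. f (e x))"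
proof -
  have [measurable_cong]: "sets R = sets M" and R1: "prob_space R"
    using R by (auto simp: space_prob_algebra)
  note e[measurable] f[measurable]
  let ?h = "\<lambda>x. f (e x)"
  let ?Q = "density R ?h" and ?c = "\<integral>y. ln (enn2real (f y)) \<partial>\<nu>"
  interpret R: prob_space R by fact
  have eQ: "distr ?Q borel e = \<nu>"
    unfolding \<nu> by (subst density_distr) auto
  have Q1: "prob_space ?Q"
    using \<nu>1 unfolding eQ[symmetric] by (rule prob_space_distrD[rotated]) simp
  have Qc: "?Q \<in> space (prob_algebra M)"
    using Q1 by (simp add: space_prob_algebra \<open>sets R = sets M\<close>)
  have lnh: "integrable P (\<lambda>x. ln (enn2real (?h x)))"
      "(\<integral>x. ln (enn2real (?h x)) \<partial>P) = ?c"
    if [measurable_cong]: "sets P = sets M" and eP: "distr P borel e = \<nu>" for P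
  proof -
    show "integrable P (\<lambda>x. ln (enn2real (?h x)))"
      using fin unfolding eP[symmetric] by (subst (asm) integrable_distr_eq) auto
    show "(\<integral>x. ln (enn2real (?h x)) \<partial>P) = ?c"
      unfolding eP[symmetric] by (subst integral_distr) auto
  qed
  have Qfin: "relative_entropy ?Q R = ereal ?c"
    using lnh[of ?Q] eQ by (subst relative_entropy_density[OF R1]) (auto simp: \<open>sets R = sets M\<close>)
  \<comment> \<open>Competitors of infinite entropy exceed the finite constant \<open>?c\<close>.
    All others have a density \<open>g\<close> with integrable logarithm, to which Gibbs' inequality
    applies.\<close>
  have min: "ereal ?c \<le> relative_entropy P R \<and> (relative_entropy P R = ereal ?c \<longrightarrow> P = ?Q)"
    if P: "P \<in> space (prob_algebra M)" and eP: "distr P borel e = \<nu>" for P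
  proof (cases "relative_entropy P R = \<infinity>")
    case False
    have sP[measurable_cong]: "sets P = sets M" and P1: "prob_space P"
      using P by (auto simp: space_prob_algebra)
    from False have "absolutely_continuous R P"
      by (auto simp: relative_entropy_def split: if_splits)
    then have P_eq: "P = density R (RN_deriv R P)"
      using sP \<open>sets R = sets M\<close> by (simp add: R.density_RN_deriv)
    define g where "g = RN_deriv R P"
    have [measurable]: "g \<in> borel_measurable R" by (simp add: g_def)
    have Pg: "P = density R g" using P_eq by (simp add: g_def)
    have lg: "integrable (density R g) (\<lambda>x. ln (enn2real (g x)))"
      and reP: "relative_entropy P R = ereal (\<integral>x. ln (enn2real (g x)) \<partial>density R g)"
      using False by (auto simp: Pg relative_entropy_density[OF R1] split: if_splits)
    \<comment> \<open>Positivity of \<open>f\<close> holds almost surely under \<open>\<nu>\<close>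
      and is pulled back to the competitor along its image constraint.\<close>
    have "AE y in \<nu>. 0 < f y \<and> f y < \<infinity>"
      using \<nu>1 unfolding \<nu> by (intro AE_density_pos_finite) auto
    then have pos: "AE x in density R g. 0 < ?h x \<and> ?h x < \<infinity>"
      unfolding eP[symmetric] Pg[symmetric] by (rule AE_distrD[rotated]) simp
    have *: "integrable (density R g) (\<lambda>x. ln (enn2real (?h x)))"
       "(\<integral>x. ln (enn2real (?h x)) \<partial>density R g) = ?c"
      using lnh[OF sP eP] by (auto simp: Pg)
    have h_meas: "?h \<in> borel_measurable R" by measurable
    have "prob_space (density R g)" using P1 Pg by simp
    note D = integral_ln_density_le[OF \<open>g \<in> borel_measurable R\<close> h_meas this Q1 pos lg *(1)]
    show ?thesis using D *(2) reP Pg by auto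
  qed simp
  show ?thesis
  proof
    assume "entropy_minimiser M e R \<nu> Q"
    then have "Q \<in> space (prob_algebra M)" "distr Q borel e = \<nu>"
      and "\<not> relative_entropy ?Q R < relative_entropy Q R"
      using Qc eQ by (auto simp: entropy_minimiser_def is_arg_min_def)
    then show "Q = ?Q"
      using min[of Q] Qfin by (auto simp: not_less intro: antisym)
  next
    assume Q: "Q = ?Q"
    show "entropy_minimiser M e R \<nu> Q"
      unfolding entropy_minimiser_def is_arg_min_def
    proof (intro conjI notI)
      show "Q \<in> space (prob_algebra M)" "distr Q borel e = \<nu>"
        using Q Qc eQ by simp_all
      assume "\<exists>P. (P \<in> space (prob_algebra M) \<and> distr P borel e = \<nu>) \<and>
        relative_entropy P R < relative_entropy Q R"
      then obtain P where "P \<in> space (prob_algebra M)" "distr P borel e = \<nu>"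
        and "relative_entropy P R < ereal ?c"
        unfolding Q Qfin by blast
      with min[of P] show False by (meson leD)
    qed
  qed
qed

section \<open>Countable generation of the path space\<close>

text \<open>The pi-system generated by \<open>S\<close> inside \<open>\<Omega>\<close>. The factor
  \<open>\<Omega>\<close> gives the empty family the intersection \<open>\<Omega>\<close> instead of
  \<open>UNIV\<close>.\<close>

definition finite_intersections :: "'a set \<Rightarrow> 'a set set \<Rightarrow> 'a set set" where
  "finite_intersections \<Omega> S = (\<lambda>F. \<Inter>F \<inter> \<Omega>) ` {F. finite F \<and> F \<subseteq> S}"

lemma finite_intersections_subset_Pow: "finite_intersections \<Omega> S \<subseteq> Pow \<Omega>"
  by (auto simp: finite_intersections_def)

lemma top_in_finite_intersections: "\<Omega> \<in> finite_intersections \<Omega> S"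
  unfolding finite_intersections_def by (rule image_eqI[of _ _ "{}"]) auto

lemma countable_finite_intersections: "countable S \<Longrightarrow> countable (finite_intersections \<Omega> S)"
  unfolding finite_intersections_def by (intro countable_image countable_Collect_finite_subset)

lemma finite_intersections_Int:
  assumes "A \<in> finite_intersections \<Omega> S" "B \<in> finite_intersections \<Omega> S"
  shows "A \<inter> B \<in> finite_intersections \<Omega> S"
proof -
  from assms obtain F G where "A = \<Inter>F \<inter> \<Omega>" "B = \<Inter>G \<inter> \<Omega>"
    "finite F" "F \<subseteq> S" "finite G" "G \<subseteq> S"
    by (auto simp: finite_intersections_def)
  then have "A \<inter> B = \<Inter>(F \<union> G) \<inter> \<Omega>" "finite (F \<union> G)" "F \<union> G \<subseteq> S" by auto
  then show ?thesis unfolding finite_intersections_def by blast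
qed

lemma Int_stable_finite_intersections: "Int_stable (finite_intersections \<Omega> S)"
  by (simp add: Int_stable_def finite_intersections_Int)

lemma sigma_sets_finite_intersections:
  assumes S: "S \<subseteq> Pow \<Omega>"
  shows "sigma_sets \<Omega> (finite_intersections \<Omega> S) = sigma_sets \<Omega> S"
proof (rule sigma_sets_eqI)
  interpret sigma_algebra \<Omega> "sigma_sets \<Omega> S" by (rule sigma_algebra_sigma_sets[OF S])
  fix A assume "A \<in> finite_intersections \<Omega> S"
  then obtain F where F: "finite F" "F \<subseteq> S" "A = \<Inter>F \<inter> \<Omega>"
    by (auto simp: finite_intersections_def)
  from F(1,2) have "\<Inter>F \<inter> \<Omega> \<in> sigma_sets \<Omega> S"
  proof induction
    case (insert B F)
    then have "B \<inter> (\<Inter>F \<inter> \<Omega>) \<in> sigma_sets \<Omega> S"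
      by (intro Int[OF sigma_sets.Basic insert.IH]) auto
    then show ?case by (simp add: Int_assoc)
  qed simp
  then show "A \<in> sigma_sets \<Omega> S" by (simp add: F)
next
  fix A assume "A \<in> S"
  then have "A \<in> finite_intersections \<Omega> S"
    unfolding finite_intersections_def using S by (intro image_eqI[of _ _ "{A}"]) auto
  then show "A \<in> sigma_sets \<Omega> (finite_intersections \<Omega> S)" by (rule sigma_sets.Basic)
qed

section \<open>Borel structure of the path space\<close>

lemma topspace_path_topology: "topspace (path_topology I) = paths I"
  unfolding path_topology_def topology_generated_by_topspace
  \<comment> \<open>For the empty compact set the condition on paths is vacuous, so
    \<open>paths I\<close> is itself a subbasic set.\<close>
  by (rule antisym) (auto intro!: exI[of _ "{}"])

lemma space_path_borel: "space (path_borel I) = paths I"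
  and sets_path_borel: "sets (path_borel I) = sigma_sets (paths I) {U. openin (path_topology I) U}"
proof -
  have "{U. openin (path_topology I) U} \<subseteq> Pow (paths I)"
    using openin_subset[of "path_topology I"] by (auto simp: topspace_path_topology)
  then show "space (path_borel I) = paths I"
    and "sets (path_borel I) = sigma_sets (paths I) {U. openin (path_topology I) U}"
    unfolding path_borel_def topspace_path_topology
    by (rule space_measure_of, rule sets_measure_of)
qed

lemma openin_path_topology_subbasic:
  "compact K \<Longrightarrow> K \<subseteq> I \<Longrightarrow> open U \<Longrightarrow> openin (path_topology I) {f \<in> paths I. f ` K \<subseteq> U}"
  unfolding path_topology_def by (rule topology_generated_by_Basis) auto

text \<open>Singletons are compact, so preimages of open sets under evaluation are subbasic open
  sets.\<close>

lemma measurable_path_eval: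
  assumes "u \<in> I"
  shows "(\<lambda>f. f u) \<in> path_borel I \<rightarrow>\<^sub>M borel"
proof (rule borel_measurableI)
  fix S :: "'a set" assume "open S"
  with openin_path_topology_subbasic[of "{u}" I S] assms
  show "(\<lambda>f. f u) -` S \<inter> space (path_borel I) \<in> sets (path_borel I)"
    by (auto simp: sets_path_borel space_path_borel vimage_def Int_def conj_commute intro: sigma_sets.Basic)
qed

text \<open>For the half-open interval the cut-off \<open>c\<close> keeps the trace away from the
  missing endpoint \<open>s\<close>; for the closed interval any \<open>c\<close> below
  \<open>x\<close> would do.\<close>

lemma interval_locally_compact:
  fixes s t x :: real
  assumes "I = {s<..t} \<or> I = {s..t}" "x \<in> I"
  obtains c where "c < x" "\<And>a b. c < a \<Longrightarrow> compact ({a..b} \<inter> I)"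
proof -
  from assms(1) show thesis
  proof
    assume I: "I = {s<..t}"
    show thesis
    proof (rule that)
      show "s < x" using I assms(2) by simp
      fix a b assume "s < a"
      then have "{a..b} \<inter> I = {a..min b t}" using I by auto
      then show "compact ({a..b} \<inter> I)" by simp
    qed
  next
    assume I: "I = {s..t}"
    then have "compact ({a..b} \<inter> I)" for a b by (auto intro: compact_Int)
    then show thesis using that[of "x - 1"] by simp
  qed
qed

text \<open>
  Second countability of the compact-open topology: a subbase is obtained from the compact traces of
  intervals with rational endpoints and a countable base of the target space.
\<close>

lemma path_borel_countably_generated:
  fixes s t :: real
  assumes I: "I = {s<..t} \<or> I = {s..t}"
  obtains E :: "(real \<Rightarrow> 'a::euclidean_space) set set"
  where "countable E" "E \<subseteq> Pow (paths I)" "sets (path_borel I) = sigma_sets (paths I) E"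
proof -
  obtain \<B> :: "'a set set" where \<B>: "countable \<B>" "topological_basis \<B>"
    using ex_countable_basis by blast
  define \<S> :: "(real \<Rightarrow> 'a) set set" where "\<S> = (\<lambda>(a, b, B). {f \<in> paths I. f ` ({a..b} \<inter> I) \<subseteq> B}) `
      {(a, b, B) \<in> \<rat> \<times> \<rat> \<times> \<B>. compact ({a..b} \<inter> I)}"
  define E where "E = finite_intersections (paths I) \<S>"
  have "countable \<S>"
    unfolding \<S>_def
    by (intro countable_image countable_subset[OF Collect_subset] countable_SIGMA countable_rat \<B>(1))
      (auto intro!: countable_subset[of _ "\<rat> \<times> \<rat> \<times> \<B>"] countable_SIGMA countable_rat \<B>(1))
  then have "countable E"
    unfolding E_def by (rule countable_finite_intersections)
  have S_open: "openin (path_topology I) A" if "A \<in> \<S>" for A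
    using that topological_basis_open[OF \<B>(2)]
    by (auto simp: \<S>_def intro!: openin_path_topology_subbasic)
  have E_open: "openin (path_topology I) A" if "A \<in> E" for A
  proof -
    from that obtain F where F: "A = \<Inter>F \<inter> paths I" "finite F" "F \<subseteq> \<S>"
      by (auto simp: E_def finite_intersections_def)
    have "openin (path_topology I) (paths I)"
      using openin_topspace[of "path_topology I"] by (simp only: topspace_path_topology)
    \<comment> \<open>Inserting \<open>paths I\<close> keeps the family nonempty, so that the
      intersection is open also for empty \<open>F\<close>.\<close>
    moreover have "A = \<Inter>(insert (paths I) F)" using F by auto
    ultimately show ?thesis
      using F S_open by (simp only:) (rule openin_Inter, auto)
  qed
  \<comment> \<open>\<open>E\<close> is a base: induction over the generation of open sets, with the
    claim quantified over all points of the open set.\<close>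
  have base: "\<exists>A\<in>E. f \<in> A \<and> A \<subseteq> U" if "openin (path_topology I) U" "f \<in> U" for U f
  proof -
    from that(1) have "generate_topology_on
        {{f \<in> paths I. f ` K \<subseteq> U} | K U. compact K \<and> K \<subseteq> I \<and> open U} U"
      unfolding path_topology_def by (rule openin_topology_generated_by)
    then have "\<forall>f\<in>U. \<exists>A\<in>E. f \<in> A \<and> A \<subseteq> U"
    proof induction
      case (Int U V)
      show ?case
      proof
        fix f assume "f \<in> U \<inter> V"
        with Int.IH obtain A B where "A \<in> E" "f \<in> A" "A \<subseteq> U" "B \<in> E" "f \<in> B" "B \<subseteq> V" by blast
        then show "\<exists>A\<in>E. f \<in> A \<and> A \<subseteq> U \<inter> V"
          by (intro bexI[of _ "A \<inter> B"]) (auto simp: E_def finite_intersections_Int)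
      qed
    next
      case (UN \<K>)
      then show ?case by (meson Union_iff Union_upper subset_trans)
    next
      case (Basis U)
      then obtain K V where U: "U = {f \<in> paths I. f ` K \<subseteq> V}"
        and K: "compact K" "K \<subseteq> I" and V: "open V" by blast
      show ?case
      proof
        fix f assume "f \<in> U"
        then have f: "f \<in> paths I" "f ` K \<subseteq> V" by (auto simp: U)
        \<comment> \<open>Continuity at \<open>x\<close> gives a basic set \<open>B\<close> inside
          \<open>V\<close> and a neighbourhood mapped into it. A rational interval around
          \<open>x\<close> is then chosen small enough to lie in this neighbourhood and to have
          compact trace on \<open>I\<close>.\<close>
        have "\<exists>a b B. a \<in> \<rat> \<and> b \<in> \<rat> \<and> B \<in> \<B> \<and> compact ({a..b} \<inter> I) \<and> x \<in> {a<..<b} \<and>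
            f ` ({a..b} \<inter> I) \<subseteq> B \<and> B \<subseteq> V" if "x \<in> K" for x
        proof -
          have "x \<in> I" "f x \<in> V" using that K f by auto
          then obtain B where B: "B \<in> \<B>" "f x \<in> B" "B \<subseteq> V"
            using topological_basisE[OF \<B>(2) V] by blast
          have "continuous_on I f" using f by (simp add: paths_def)
          moreover have "open B" using topological_basis_open[OF \<B>(2) B(1)] .
          ultimately obtain W where W: "open W" "x \<in> W" "\<forall>y\<in>I. y \<in> W \<longrightarrow> f y \<in> B"
            using \<open>x \<in> I\<close> B(2) by (simp only: continuous_on_topological) blast
          then obtain d where d: "d > 0" "ball x d \<subseteq> W"
            using openE by blast
          obtain c where c: "c < x" "\<And>a b. c < a \<Longrightarrow> compact ({a..b} \<inter> I)"
            using interval_locally_compact[OF I \<open>x \<in> I\<close>] by blast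
          obtain a where a: "a \<in> \<rat>" "max c (x - d) < a" "a < x"
            using Rats_dense_in_real[of "max c (x - d)" x] c d by auto
          obtain b where b: "b \<in> \<rat>" "x < b" "b < x + d"
            using Rats_dense_in_real[of x "x + d"] d by auto
          have "{a..b} \<subseteq> ball x d" using a b by (auto simp: dist_real_def)
          then have "f ` ({a..b} \<inter> I) \<subseteq> B" using W(3) d by auto
          then show ?thesis using a b c B by (intro exI[of _ a] exI[of _ b] exI[of _ B]) auto
        qed
        then obtain a b B where *: "\<And>x. x \<in> K \<Longrightarrow> a x \<in> \<rat> \<and> b x \<in> \<rat> \<and> B x \<in> \<B> \<and>
            compact ({a x..b x} \<inter> I) \<and> x \<in> {a x<..<b x} \<and> f ` ({a x..b x} \<inter> I) \<subseteq> B x \<and> B x \<subseteq> V"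
          by metis
        \<comment> \<open>The open intervals cover \<open>K\<close>; a finite subcover turns the
          local conditions into finitely many members of \<open>\<S>\<close>.\<close>
        obtain C where C: "C \<subseteq> K" "finite C" "K \<subseteq> (\<Union>x\<in>C. {a x<..<b x})"
        proof (rule compactE_image[OF K(1)])
          show "open {a x<..<b x}" for x by simp
          show "K \<subseteq> (\<Union>x\<in>K. {a x<..<b x})" using * by blast
        qed
        define F where "F = (\<lambda>x. {g \<in> paths I. g ` ({a x..b x} \<inter> I) \<subseteq> B x}) ` C"
        have "F \<subseteq> \<S>"
        proof
          fix A assume "A \<in> F"
          then obtain x where x: "x \<in> C" "A = {g \<in> paths I. g ` ({a x..b x} \<inter> I) \<subseteq> B x}"
            by (auto simp: F_def)
          then show "A \<in> \<S>" unfolding \<S>_def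
            using *[of x] C(1) by (intro image_eqI[of _ _ "(a x, b x, B x)"]) auto
        qed
        moreover have "finite F" using C(2) by (simp add: F_def)
        ultimately have "\<Inter>F \<inter> paths I \<in> E"
          unfolding E_def finite_intersections_def by blast
        moreover have "f \<in> \<Inter>F \<inter> paths I" using f(1) * C(1) unfolding F_def by blast
        moreover have "\<Inter>F \<inter> paths I \<subseteq> U"
        proof
          fix g assume g: "g \<in> \<Inter>F \<inter> paths I"
          have "g y \<in> V" if "y \<in> K" for y
          proof -
            have "y \<in> (\<Union>x\<in>C. {a x<..<b x})" using C(3) that by (rule subsetD)
            then obtain x where x: "x \<in> C" "y \<in> {a x<..<b x}" by (rule UN_E)
            have "g ` ({a x..b x} \<inter> I) \<subseteq> B x" using g x(1) by (auto simp: F_def)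
            moreover have "y \<in> {a x..b x} \<inter> I" using x(2) that K(2) by auto
            ultimately show ?thesis using *[of x] x(1) C(1) by blast
          qed
          then show "g \<in> U" using g by (auto simp: U)
        qed
        ultimately show "\<exists>A\<in>E. f \<in> A \<and> A \<subseteq> U" by blast
      qed
    qed simp
    with that(2) show ?thesis by blast
  qed
  have E_Pow: "E \<subseteq> Pow (paths I)" by (simp add: E_def finite_intersections_subset_Pow)
  have "sigma_sets (paths I) {U. openin (path_topology I) U} = sigma_sets (paths I) E"
  proof (rule sigma_sets_eqI)
    show "U \<in> sigma_sets (paths I) E" if "U \<in> {U. openin (path_topology I) U}" for U
    proof -
      \<comment> \<open>An open set is the union of the base sets it contains, a countable union
        because \<open>E\<close> is countable.\<close>
      have "U = \<Union>{A \<in> E. A \<subseteq> U}" using base[of U] that by blast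
      moreover have "\<Union>{A \<in> E. A \<subseteq> U} \<in> sigma_sets (paths I) E"
        using \<open>countable E\<close>
        by (intro sigma_algebra.countable_Union[OF sigma_algebra_sigma_sets[OF E_Pow]])
          (auto intro: countable_subset[rotated])
      ultimately show ?thesis by simp
    qed
  qed (use E_open in auto)
  then show thesis
    using \<open>countable E\<close> E_Pow by (intro that) (simp_all add: sets_path_borel)
qed

section \<open>Disintegrations\<close>

context
  fixes M :: "'a measure" and N :: "'b measure" and \<mu> K
  assumes \<mu>: "\<mu> \<in> space (prob_algebra M)" and K[measurable]: "K \<in> M \<rightarrow>\<^sub>M prob_algebra N"
begin

text \<open>Naming the sigma-algebra by \<open>M\<close> instead of \<open>\<mu>\<close> makes the
  right-hand side a measurable function of the measure, and so accessible to the measurability rules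
  for \<open>prob_algebra\<close>.\<close>

lemma kernel_product_eq_bind:
  "kernel_product \<mu> N K = \<mu> \<bind> (\<lambda>x. K x \<bind> (\<lambda>y. return (M \<Otimes>\<^sub>M N) (x, y)))"
proof -
  have "return (\<mu> \<Otimes>\<^sub>M N) = return (M \<Otimes>\<^sub>M N)"
    using \<mu> by (intro return_sets_cong sets_pair_measure_cong) (auto simp: space_prob_algebra)
  then show ?thesis by (simp add: kernel_product_def)
qed

lemma kernel_product_prob_algebra: "kernel_product \<mu> N K \<in> space (prob_algebra (M \<Otimes>\<^sub>M N))"
proof -
  have "(\<lambda>\<mu>. \<mu> \<bind> (\<lambda>x. K x \<bind> (\<lambda>y. return (M \<Otimes>\<^sub>M N) (x, y)))) \<in> prob_algebra M \<rightarrow>\<^sub>M prob_algebra (M \<Otimes>\<^sub>M N)"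
    by measurable
  from measurable_space[OF this \<mu>] show ?thesis by (simp add: kernel_product_eq_bind)
qed

lemma sets_kernel_product: "sets (kernel_product \<mu> N K) = sets (M \<Otimes>\<^sub>M N)"
  using kernel_product_prob_algebra by (simp add: space_prob_algebra)

text \<open>Tonelli's theorem for kernels, from two applications of the integral of a monadic bind.
  All later computations with kernel products go through it.\<close>

lemma nn_integral_kernel_product:
  assumes g[measurable]: "g \<in> borel_measurable (M \<Otimes>\<^sub>M N)"
  shows "(\<integral>\<^sup>+z. g z \<partial>kernel_product \<mu> N K) = (\<integral>\<^sup>+x. \<integral>\<^sup>+y. g (x, y) \<partial>K x \<partial>\<mu>)"
proof -
  have s[measurable_cong]: "sets \<mu> = sets M" using \<mu> by (simp add: space_prob_algebra)
  have "(\<integral>\<^sup>+z. g z \<partial>kernel_product \<mu> N K)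
      = (\<integral>\<^sup>+x. \<integral>\<^sup>+z. g z \<partial>(K x \<bind> (\<lambda>y. return (M \<Otimes>\<^sub>M N) (x, y))) \<partial>\<mu>)"
    unfolding kernel_product_eq_bind
    by (rule nn_integral_bind[OF g]) (intro measurable_prob_algebraD, measurable)
  also have "\<dots> = (\<integral>\<^sup>+x. \<integral>\<^sup>+y. g (x, y) \<partial>K x \<partial>\<mu>)"
  proof (rule nn_integral_cong)
    fix x assume "x \<in> space \<mu>"
    then have x: "x \<in> space M" using sets_eq_imp_space_eq[OF s] by simp
    have sK[measurable_cong]: "sets (K x) = sets N" and spK: "space (K x) = space N"
      using subprob_measurableD[OF measurable_prob_algebraD[OF K] x] by auto
    have [measurable]: "x \<in> space M" by (fact x)
    have "(\<integral>\<^sup>+z. g z \<partial>(K x \<bind> (\<lambda>y. return (M \<Otimes>\<^sub>M N) (x, y))))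
        = (\<integral>\<^sup>+y. \<integral>\<^sup>+z. g z \<partial>return (M \<Otimes>\<^sub>M N) (x, y) \<partial>K x)"
      by (rule nn_integral_bind[OF g]) measurable
    also have "\<dots> = (\<integral>\<^sup>+y. g (x, y) \<partial>K x)"
      by (rule nn_integral_cong, rule nn_integral_return)
        (auto simp: spK space_pair_measure x)
    finally show "(\<integral>\<^sup>+z. g z \<partial>(K x \<bind> (\<lambda>y. return (M \<Otimes>\<^sub>M N) (x, y)))) = (\<integral>\<^sup>+y. g (x, y) \<partial>K x)" .
  qed
  finally show ?thesis .
qed

lemma emeasure_kernel_product_Times:
  assumes [measurable]: "A \<in> sets M" "B \<in> sets N"
  shows "emeasure (kernel_product \<mu> N K) (A \<times> B) = (\<integral>\<^sup>+x. emeasure (K x) B * indicator A x \<partial>\<mu>)"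
proof -
  have "emeasure (kernel_product \<mu> N K) (A \<times> B) = (\<integral>\<^sup>+z. indicator (A \<times> B) z \<partial>kernel_product \<mu> N K)"
    by (simp add: sets_kernel_product)
  also have "\<dots> = (\<integral>\<^sup>+x. \<integral>\<^sup>+y. indicator (A \<times> B) (x, y) \<partial>K x \<partial>\<mu>)"
    by (rule nn_integral_kernel_product) simp
  also have "\<dots> = (\<integral>\<^sup>+x. emeasure (K x) B * indicator A x \<partial>\<mu>)"
  proof (rule nn_integral_cong)
    fix x assume "x \<in> space \<mu>"
    then have x: "x \<in> space M" using \<mu> by (auto simp: space_prob_algebra dest: sets_eq_imp_space_eq)
    have "B \<in> sets (K x)"
      using subprob_measurableD[OF measurable_prob_algebraD[OF K] x] by auto
    moreover have "indicator (A \<times> B) (x, y) = (indicator B y * indicator A x :: ennreal)" for y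
      by (simp add: indicator_times mult.commute)
    ultimately show "(\<integral>\<^sup>+y. indicator (A \<times> B) (x, y) \<partial>K x) = emeasure (K x) B * indicator A x"
      by (simp add: nn_integral_multc)
  qed
  finally show ?thesis .
qed

lemma distr_kernel_product_fst: "distr (kernel_product \<mu> N K) M fst = \<mu>"
proof (rule measure_eqI)
  fix A assume "A \<in> sets (distr (kernel_product \<mu> N K) M fst)"
  then have [measurable]: "A \<in> sets M" by simp
  have "fst -` A \<inter> space (kernel_product \<mu> N K) = A \<times> space N"
    using sets.sets_into_space[OF \<open>A \<in> sets M\<close>] sets_eq_imp_space_eq[OF sets_kernel_product]
    by (auto simp: space_pair_measure)
  then have "emeasure (distr (kernel_product \<mu> N K) M fst) A = emeasure (kernel_product \<mu> N K) (A \<times> space N)"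
    by (subst emeasure_distr) (simp_all add: measurable_cong_sets[OF sets_kernel_product refl])
  also have "\<dots> = (\<integral>\<^sup>+x. indicator A x \<partial>\<mu>)"
  proof (subst emeasure_kernel_product_Times, simp, simp, rule nn_integral_cong)
    fix x assume "x \<in> space \<mu>"
    then have "x \<in> space M" using \<mu> by (auto simp: space_prob_algebra dest: sets_eq_imp_space_eq)
    from measurable_space[OF K this] have "prob_space (K x)" "space (K x) = space N"
      by (auto simp: space_prob_algebra dest: sets_eq_imp_space_eq)
    then show "emeasure (K x) (space N) * indicator A x = indicator A x"
      using prob_space.emeasure_space_1[of "K x"] by simp
  qed
  also have "\<dots> = emeasure \<mu> A"
    using \<mu> by (simp add: space_prob_algebra)
  finally show "emeasure (distr (kernel_product \<mu> N K) M fst) A = emeasure \<mu> A" .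
qed (use \<mu> in \<open>simp add: space_prob_algebra\<close>)

end

text \<open>For fixed \<open>B\<close> both \<open>\<lambda>x. emeasure (K x) B\<close> and its
  counterpart for \<open>K'\<close> are densities of the same measure, the mass of
  \<open>A \<times> B\<close> as a function of \<open>A\<close>. A countable generating pi-system
  leaves countably many null sets to discard.\<close>

lemma kernel_product_AE_unique:
  assumes S: "countable S" "S \<subseteq> Pow \<Omega>" "sets N = sigma_sets \<Omega> S"
    and \<mu>: "\<mu> \<in> space (prob_algebra M)"
    and K[measurable]: "K \<in> M \<rightarrow>\<^sub>M prob_algebra N" and K'[measurable]: "K' \<in> M \<rightarrow>\<^sub>M prob_algebra N"
    and eq: "kernel_product \<mu> N K = kernel_product \<mu> N K'"
  shows "AE x in \<mu>. K x = K' x"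
proof -
  have s[measurable_cong]: "sets \<mu> = sets M" and P: "prob_space \<mu>"
    using \<mu> by (auto simp: space_prob_algebra)
  interpret prob_space \<mu> by fact
  define E where "E = finite_intersections \<Omega> S"
  have E: "countable E" "Int_stable E" "E \<subseteq> Pow \<Omega>" "\<Omega> \<in> E" "sets N = sigma_sets \<Omega> E"
    using S by (simp_all add: E_def countable_finite_intersections Int_stable_finite_intersections
        finite_intersections_subset_Pow top_in_finite_intersections sigma_sets_finite_intersections)
  have "AE x in \<mu>. emeasure (K x) B = emeasure (K' x) B" if "B \<in> E" for B
  proof -
    have B[measurable]: "B \<in> sets N" using that E(5) by (auto intro: sigma_sets.Basic)
    have [measurable]: "(\<lambda>x. emeasure (K x) B) \<in> borel_measurable \<mu>"
      "(\<lambda>x. emeasure (K' x) B) \<in> borel_measurable \<mu>"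
      using measurable_emeasure_kernel[OF measurable_prob_algebraD[OF K] B]
        measurable_emeasure_kernel[OF measurable_prob_algebraD[OF K'] B]
      by (simp_all add: measurable_cong_sets[OF s refl])
    show ?thesis
    proof (rule density_unique, simp, simp, rule measure_eqI)
      fix A assume "A \<in> sets (density \<mu> (\<lambda>x. emeasure (K x) B))"
      then have A: "A \<in> sets M" using s by simp
      show "emeasure (density \<mu> (\<lambda>x. emeasure (K x) B)) A = emeasure (density \<mu> (\<lambda>x. emeasure (K' x) B)) A"
        using emeasure_kernel_product_Times[OF \<mu> K A B] emeasure_kernel_product_Times[OF \<mu> K' A B] A s
        by (simp add: emeasure_density eq)
    qed simp
  qed
  then have "AE x in \<mu>. \<forall>B\<in>E. emeasure (K x) B = emeasure (K' x) B"
    using E(1) by (simp add: AE_ball_countable)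
  with AE_space show ?thesis
  proof eventually_elim
    case (elim x)
    then have x: "x \<in> space M" using sets_eq_imp_space_eq[OF s] by simp
    have *: "sets (K x) = sets N" "sets (K' x) = sets N" "prob_space (K x)"
      using measurable_space[OF K x] measurable_space[OF K' x] by (auto simp: space_prob_algebra)
    interpret Kx: prob_space "K x" by fact
    \<comment> \<open>Agreement on \<open>E\<close> extends to the generated sigma-algebra, with the
      single set \<open>\<Omega>\<close> of finite mass as exhausting family.\<close>
    show ?case
      using elim E * by (intro measure_eqI_generator_eq_countable[where A="{\<Omega>}" and E=E and \<Omega>=\<Omega>]) auto
  qed
qed

section \<open>Disintegrating a density against a kernel product\<close>

text \<open>
  The fallback \<open>K x\<close>, used where the density cannot be normalised, makes this a probability kernel
  everywhere and not just almost everywhere.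
\<close>

definition conditional_density :: "('a \<Rightarrow> 'b measure) \<Rightarrow> ('a \<Rightarrow> 'b \<Rightarrow> ennreal) \<Rightarrow> 'a \<Rightarrow> 'b measure" where
  "conditional_density K f x =
     (let c = \<integral>\<^sup>+y. f x y \<partial>K x in if 0 < c \<and> c < \<infinity> then density (K x) (\<lambda>y. f x y / c) else K x)"

context
  fixes M :: "'a measure" and N :: "'b measure" and K and f :: "'a \<Rightarrow> 'b \<Rightarrow> ennreal"
  assumes K[measurable]: "K \<in> M \<rightarrow>\<^sub>M prob_algebra N"
    and f[measurable]: "(\<lambda>(x, y). f x y) \<in> borel_measurable (M \<Otimes>\<^sub>M N)"
begin

private lemma K_kernel: "K \<in> M \<rightarrow>\<^sub>M subprob_algebra N"
  using K by (rule measurable_prob_algebraD)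

lemma measurable_marginal_density: "(\<lambda>x. \<integral>\<^sup>+y. f x y \<partial>K x) \<in> borel_measurable M"
  using f K_kernel by (rule nn_integral_measurable_subprob_algebra2)

lemma measurable_section: "x \<in> space M \<Longrightarrow> f x \<in> borel_measurable (K x)"
proof -
  assume x: "x \<in> space M"
  then have "sets (K x) = sets N" using subprob_measurableD(2)[OF K_kernel] by simp
  moreover have "f x \<in> borel_measurable N" using measurable_Pair2[OF f x] by simp
  ultimately show ?thesis using measurable_cong_sets by blast
qed

lemma measurable_conditional_density: "conditional_density K f \<in> M \<rightarrow>\<^sub>M prob_algebra N"
proof (rule measurable_prob_algebraI)
  let ?c = "\<lambda>x. \<integral>\<^sup>+y. f x y \<partial>K x"
  note measurable_marginal_density[measurable]
  have sets: "sets (conditional_density K f x) = sets N" if "x \<in> space M" for x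
    using subprob_measurableD(2)[OF K_kernel that] by (simp add: conditional_density_def Let_def)
  show prob: "prob_space (conditional_density K f x)" if x: "x \<in> space M" for x
  proof (cases "0 < ?c x \<and> ?c x < \<infinity>")
    case True
    note measurable_section[OF x, measurable]
    have "(\<integral>\<^sup>+y. f x y / ?c x \<partial>K x) = ?c x / ?c x"
      by (rule nn_integral_divide) simp
    also have "\<dots> = 1" using True by (intro ennreal_divide_self) auto
    finally show ?thesis
      using True by (auto simp: conditional_density_def emeasure_density cong: nn_integral_cong intro!: prob_spaceI)
  next
    case False
    then show ?thesis
      using measurable_space[OF K x] by (auto simp: conditional_density_def space_prob_algebra Let_def)
  qed
  show "conditional_density K f \<in> M \<rightarrow>\<^sub>M subprob_algebra N"
  proof (rule measurable_subprob_algebra)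
    fix A assume [measurable]: "A \<in> sets N"
    have "(\<lambda>x. if 0 < ?c x \<and> ?c x < \<infinity> then \<integral>\<^sup>+y. f x y / ?c x * indicator A y \<partial>K x else emeasure (K x) A)
        \<in> borel_measurable M" (is "?g \<in> _")
    proof -
      have [measurable]: "(\<lambda>x. \<integral>\<^sup>+y. f x y / ?c x * indicator A y \<partial>K x) \<in> borel_measurable M"
        by (rule nn_integral_measurable_subprob_algebra2[OF _ K_kernel]) measurable
      have [measurable]: "(\<lambda>x. emeasure (K x) A) \<in> borel_measurable M"
        using K_kernel by (rule measurable_emeasure_kernel) simp
      show ?thesis by measurable
    qed
    also have "?g \<in> borel_measurable M \<longleftrightarrow> (\<lambda>x. emeasure (conditional_density K f x) A) \<in> borel_measurable M"
    proof (rule measurable_cong)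
      fix x assume x: "x \<in> space M"
      note measurable_section[OF x, measurable]
      have [measurable]: "A \<in> sets (K x)" using subprob_measurableD(2)[OF K_kernel x] by simp
      show "?g x = emeasure (conditional_density K f x) A"
        by (auto simp: conditional_density_def Let_def emeasure_density)
    qed
    finally show "(\<lambda>x. emeasure (conditional_density K f x) A) \<in> borel_measurable M" .
  qed (auto simp: sets intro: prob_space_imp_subprob_space prob)
qed

text \<open>The factorisation \<open>f = c * (f / c)\<close> under the inner integral. The set where
  \<open>c\<close> is infinite is null because \<open>c\<close> integrates to 1.\<close>

lemma density_kernel_product:
  assumes \<rho>: "\<rho> \<in> space (prob_algebra M)"
    and P: "prob_space (density (kernel_product \<rho> N K) (\<lambda>(x, y). f x y))"
  shows "density \<rho> (\<lambda>x. \<integral>\<^sup>+y. f x y \<partial>K x) \<in> space (prob_algebra M)" (is "?prob")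
    and "density (kernel_product \<rho> N K) (\<lambda>(x, y). f x y)
      = kernel_product (density \<rho> (\<lambda>x. \<integral>\<^sup>+y. f x y \<partial>K x)) N (conditional_density K f)" (is "?eq")
proof -
  let ?c = "\<lambda>x. \<integral>\<^sup>+y. f x y \<partial>K x"
  note measurable_marginal_density[measurable]
  have s[measurable_cong]: "sets \<rho> = sets M" using \<rho> by (simp add: space_prob_algebra)
  have sp: "space \<rho> = space M" using s by (rule sets_eq_imp_space_eq)
  have sk[measurable_cong]: "sets (kernel_product \<rho> N K) = sets (M \<Otimes>\<^sub>M N)"
    by (rule sets_kernel_product[OF \<rho> K])
  have "1 = (\<integral>\<^sup>+z. (case z of (x, y) \<Rightarrow> f x y) \<partial>kernel_product \<rho> N K)"
    using prob_space.emeasure_space_1[OF P] by (simp add: emeasure_density cong: nn_integral_cong)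
  also have "\<dots> = (\<integral>\<^sup>+x. ?c x \<partial>\<rho>)"
    by (simp add: nn_integral_kernel_product[OF \<rho> K])
  finally have int1: "(\<integral>\<^sup>+x. ?c x \<partial>\<rho>) = 1" ..
  then have "prob_space (density \<rho> ?c)"
    by (auto simp: emeasure_density cong: nn_integral_cong intro!: prob_spaceI)
  then show prob: ?prob by (simp add: space_prob_algebra s)
  have fin: "AE x in \<rho>. ?c x \<noteq> \<infinity>"
    using int1 by (intro nn_integral_PInf_AE) auto
  note C = measurable_conditional_density
  show ?eq
  proof (rule measure_eqI)
    show "sets (density (kernel_product \<rho> N K) (\<lambda>(x, y). f x y))
        = sets (kernel_product (density \<rho> ?c) N (conditional_density K f))"
      by (simp add: sk sets_kernel_product[OF prob C])
    fix A assume "A \<in> sets (density (kernel_product \<rho> N K) (\<lambda>(x, y). f x y))"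
    then have A[measurable]: "A \<in> sets (M \<Otimes>\<^sub>M N)" by (simp add: sk)
    have "emeasure (density (kernel_product \<rho> N K) (\<lambda>(x, y). f x y)) A
        = (\<integral>\<^sup>+z. (case z of (x, y) \<Rightarrow> f x y) * indicator A z \<partial>kernel_product \<rho> N K)"
      by (simp add: emeasure_density)
    also have "\<dots> = (\<integral>\<^sup>+x. \<integral>\<^sup>+y. f x y * indicator A (x, y) \<partial>K x \<partial>\<rho>)"
      by (subst nn_integral_kernel_product[OF \<rho> K]) auto
    also have "\<dots> = (\<integral>\<^sup>+x. ?c x * (\<integral>\<^sup>+y. indicator A (x, y) \<partial>conditional_density K f x) \<partial>\<rho>)"
    proof (rule nn_integral_cong_AE)
      from fin AE_space show "AE x in \<rho>. (\<integral>\<^sup>+y. f x y * indicator A (x, y) \<partial>K x)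
          = ?c x * (\<integral>\<^sup>+y. indicator A (x, y) \<partial>conditional_density K f x)"
      proof eventually_elim
        case (elim x)
        then have x: "x \<in> space M" by (simp add: sp)
        note measurable_section[OF x, measurable]
        have sK: "sets (K x) = sets N" using subprob_measurableD(2)[OF K_kernel x] by simp
        have [measurable]: "(\<lambda>y. indicator A (x, y) :: ennreal) \<in> borel_measurable (K x)"
          using measurable_Pair2[OF borel_measurable_indicator[OF A] x]
          by (simp add: measurable_cong_sets[OF sK refl])
        show ?case
        proof (cases "?c x = 0")
          \<comment> \<open>Here \<open>conditional_density\<close> takes its fallback value, which
            is weighted by 0; the section of \<open>f\<close> vanishes almost everywhere, so the
            other side is 0 too.\<close>
          case True
          then have "AE y in K x. f x y = 0" by (simp add: nn_integral_0_iff_AE)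
          then have "(\<integral>\<^sup>+y. f x y * indicator A (x, y) \<partial>K x) = (\<integral>\<^sup>+y. 0 \<partial>K x)"
            by (intro nn_integral_cong_AE) auto
          then show ?thesis using True by simp
        next
          case False
          then have pos: "0 < ?c x \<and> ?c x < \<infinity>" using elim by (auto simp: zero_less_iff_neq_zero less_top)
          have "?c x * (\<integral>\<^sup>+y. indicator A (x, y) \<partial>conditional_density K f x)
              = ?c x * (\<integral>\<^sup>+y. f x y / ?c x * indicator A (x, y) \<partial>K x)"
            using pos by (simp add: conditional_density_def nn_integral_density)
          also have "\<dots> = (\<integral>\<^sup>+y. ?c x * (f x y / ?c x * indicator A (x, y)) \<partial>K x)"
            by (rule nn_integral_cmult[symmetric]) simp
          also have "\<dots> = (\<integral>\<^sup>+y. f x y * indicator A (x, y) \<partial>K x)"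
          proof (rule nn_integral_cong)
            fix y
            have "?c x * (f x y / ?c x) = f x y"
              using pos by (simp add: ennreal_times_divide mult.commute[of "?c x"])
                (simp add: ennreal_mult_divide_eq less_top zero_less_iff_neq_zero)
            then show "?c x * (f x y / ?c x * indicator A (x, y)) = f x y * indicator A (x, y)"
              by (simp add: mult.assoc[symmetric])
          qed
          finally show ?thesis ..
        qed
      qed
    qed
    also have "\<dots> = (\<integral>\<^sup>+x. \<integral>\<^sup>+y. indicator A (x, y) \<partial>conditional_density K f x \<partial>density \<rho> ?c)"
      by (rule nn_integral_density[symmetric])
        (auto intro!: nn_integral_measurable_subprob_algebra2[OF _ measurable_prob_algebraD[OF C]]
          simp: measurable_cong_sets[OF s refl])
    also have "\<dots> = emeasure (kernel_product (density \<rho> ?c) N (conditional_density K f)) A"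
      by (subst nn_integral_kernel_product[OF prob C, symmetric]) (simp_all add: sets_kernel_product[OF prob C])
    finally show "emeasure (density (kernel_product \<rho> N K) (\<lambda>(x, y). f x y)) A
        = emeasure (kernel_product (density \<rho> ?c) N (conditional_density K f)) A" .
  qed
qed

end

lemma kernel_product_cong_AE:
  assumes \<mu>: "\<mu> \<in> space (prob_algebra M)"
    and K: "K \<in> M \<rightarrow>\<^sub>M prob_algebra N" and K': "K' \<in> M \<rightarrow>\<^sub>M prob_algebra N"
    and eq: "AE x in \<mu>. K x = K' x"
  shows "kernel_product \<mu> N K = kernel_product \<mu> N K'"
proof (rule measure_eqI)
  note sets = sets_kernel_product[OF \<mu> K] sets_kernel_product[OF \<mu> K']
  then show "sets (kernel_product \<mu> N K) = sets (kernel_product \<mu> N K')" by simp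
  fix A assume "A \<in> sets (kernel_product \<mu> N K)"
  then have A: "A \<in> sets (M \<Otimes>\<^sub>M N)" by (simp add: sets)
  have "(\<integral>\<^sup>+z. indicator A z \<partial>kernel_product \<mu> N K) = (\<integral>\<^sup>+z. indicator A z \<partial>kernel_product \<mu> N K')"
    unfolding nn_integral_kernel_product[OF \<mu> K borel_measurable_indicator[OF A]]
      nn_integral_kernel_product[OF \<mu> K' borel_measurable_indicator[OF A]]
    using eq by (intro nn_integral_cong_AE) (auto elim!: eventually_mono)
  then show "emeasure (kernel_product \<mu> N K) A = emeasure (kernel_product \<mu> N K') A"
    using A by (simp add: sets)
qed

text \<open>Because the kernel depends on \<open>x\<close> only through \<open>p x\<close>, the
  image splits again into a marginal and a kernel. This is how triangularity passes to the endpoint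
  law.\<close>

lemma distr_kernel_product_map_prod:
  assumes \<rho>: "\<rho> \<in> space (prob_algebra M)" and p[measurable]: "p \<in> M \<rightarrow>\<^sub>M M'" and q[measurable]: "q \<in> N \<rightarrow>\<^sub>M N'"
    and K[measurable]: "K \<in> M' \<rightarrow>\<^sub>M prob_algebra N"
  shows "distr (kernel_product \<rho> N (\<lambda>x. K (p x))) (M' \<Otimes>\<^sub>M N') (map_prod p q)
    = kernel_product (distr \<rho> M' p) N' (\<lambda>x. distr (K x) N' q)" (is "?L = ?R")
proof (rule measure_eqI)
  have s[measurable_cong]: "sets \<rho> = sets M" using \<rho> by (simp add: space_prob_algebra)
  have K': "(\<lambda>x. K (p x)) \<in> M \<rightarrow>\<^sub>M prob_algebra N" by measurable
  have \<rho>': "distr \<rho> M' p \<in> space (prob_algebra M')"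
    using \<rho> by (auto simp: space_prob_algebra intro!: prob_space.prob_space_distr)
  have Kq: "(\<lambda>x. distr (K x) N' q) \<in> M' \<rightarrow>\<^sub>M prob_algebra N'" by measurable
  note sets = sets_kernel_product[OF \<rho>' Kq]
  note [measurable_cong] = sets_kernel_product[OF \<rho> K']
  show "sets ?L = sets ?R" by (simp add: sets)
  fix A assume "A \<in> sets ?L"
  then have A[measurable]: "A \<in> sets (M' \<Otimes>\<^sub>M N')" by simp
  have m[measurable]: "map_prod p q \<in> M \<Otimes>\<^sub>M N \<rightarrow>\<^sub>M M' \<Otimes>\<^sub>M N'"
    unfolding map_prod_def by measurable
  have "emeasure ?L A = (\<integral>\<^sup>+z. indicator A z \<partial>?L)"
    by simp
  also have "\<dots> = (\<integral>\<^sup>+z. indicator A (map_prod p q z) \<partial>kernel_product \<rho> N (\<lambda>x. K (p x)))"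
    by (rule nn_integral_distr) measurable
  also have "\<dots> = (\<integral>\<^sup>+x. \<integral>\<^sup>+y. indicator A (p x, q y) \<partial>K (p x) \<partial>\<rho>)"
    by (subst nn_integral_kernel_product[OF \<rho> K']) simp_all
  also have "\<dots> = (\<integral>\<^sup>+x. \<integral>\<^sup>+y. indicator A (p x, y) \<partial>distr (K (p x)) N' q \<partial>\<rho>)"
  proof (rule nn_integral_cong)
    fix x assume "x \<in> space \<rho>"
    then have x: "p x \<in> space M'" using measurable_space[OF p] sets_eq_imp_space_eq[OF s] by auto
    have [measurable_cong]: "sets (K (p x)) = sets N"
      using subprob_measurableD(2)[OF measurable_prob_algebraD[OF K] x] .
    have "(\<lambda>y. indicator A (p x, y) :: ennreal) \<in> borel_measurable N'"
      using measurable_Pair2[OF borel_measurable_indicator[OF A] x] .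
    moreover have "q \<in> K (p x) \<rightarrow>\<^sub>M N'" by measurable
    ultimately show "(\<integral>\<^sup>+y. indicator A (p x, q y) \<partial>K (p x))
        = (\<integral>\<^sup>+y. indicator A (p x, y) \<partial>distr (K (p x)) N' q)"
      by (simp add: nn_integral_distr)
  qed
  also have "\<dots> = (\<integral>\<^sup>+x. \<integral>\<^sup>+y. indicator A (x, y) \<partial>distr (K x) N' q \<partial>distr \<rho> M' p)"
    by (rule nn_integral_distr[symmetric])
      (auto intro!: nn_integral_measurable_subprob_algebra2[OF _ measurable_prob_algebraD[OF Kq]])
  also have "\<dots> = (\<integral>\<^sup>+z. indicator A z \<partial>?R)"
    by (rule nn_integral_kernel_product[OF \<rho>' Kq, symmetric]) simp
  also have "\<dots> = emeasure ?R A" by (simp add: sets)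
  finally show "emeasure ?L A = emeasure ?R A" .
qed

section \<open>Integrability of the logarithms of marginal and conditional densities\<close>

lemma nn_integral_neg_ln_density_le:
  assumes R: "prob_space R" and g[measurable]: "g \<in> borel_measurable R"
  shows "(\<integral>\<^sup>+x. ennreal (- ln (enn2real (g x))) \<partial>density R g) \<le> 1"
proof -
  interpret prob_space R by fact
  have "(\<integral>\<^sup>+x. ennreal (- ln (enn2real (g x))) \<partial>density R g)
      = (\<integral>\<^sup>+x. g x * ennreal (- ln (enn2real (g x))) \<partial>R)"
    by (rule nn_integral_density) measurable
  also have "\<dots> \<le> (\<integral>\<^sup>+x. 1 \<partial>R)"
  proof (rule nn_integral_mono)
    fix x
    show "g x * ennreal (- ln (enn2real (g x))) \<le> 1"
    proof (cases "g x")
      case (real u)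
      show ?thesis
      proof (cases "u = 0")
        case False
        then have "u > 0" using real by simp
        \<comment> \<open>The inequality \<open>ln v \<le> v - 1\<close> at
          \<open>v = 1 / u\<close>; multiplied by \<open>u\<close> it bounds the integrand by
          \<open>1 - u\<close>.\<close>
        then have "- ln u \<le> 1 / u - 1"
          using ln_le_minus_one[of "1 / u"] by (simp add: ln_div)
        then have "u * - ln u \<le> u * (1 / u - 1)"
          using \<open>u > 0\<close> by (intro mult_left_mono) auto
        also have "\<dots> \<le> 1" using \<open>u > 0\<close> by (simp add: field_simps)
        finally have "u * - ln u \<le> 1" .
        have "g x * ennreal (- ln (enn2real (g x))) = ennreal (u * - ln u)"
          unfolding real(2) using real(1) by (simp only: ennreal_mult'[symmetric] enn2real_ennreal)
        also have "\<dots> \<le> ennreal 1" using \<open>u * - ln u \<le> 1\<close> by (rule ennreal_leI)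
        finally show ?thesis by simp
      qed (simp add: real)
    \<comment> \<open>At an infinite value, \<open>enn2real\<close> returns 0 and
      \<open>ln 0 = 0\<close>, so the product is 0.\<close>
    qed simp
  qed
  also have "\<dots> = 1" by (simp add: emeasure_space_1)
  finally show ?thesis .
qed

text \<open>
  The conditional entropies are nonnegative, so \<open>ln (c x)\<close> is at most the conditional mean of
  \<open>\<bar>ln (f x y)\<bar>\<close>; its negative part is integrable because \<open>u ln u\<close> is bounded below.
\<close>

lemma integrable_ln_disintegration:
  fixes f :: "'a \<Rightarrow> 'b \<Rightarrow> ennreal"
  assumes \<rho>: "\<rho> \<in> space (prob_algebra M)" and K[measurable]: "K \<in> M \<rightarrow>\<^sub>M prob_algebra N"
    and f[measurable]: "(\<lambda>(x, y). f x y) \<in> borel_measurable (M \<Otimes>\<^sub>M N)"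
    and P: "prob_space (density (kernel_product \<rho> N K) (\<lambda>(x, y). f x y))"
    and ln: "integrable (density (kernel_product \<rho> N K) (\<lambda>(x, y). f x y)) (\<lambda>(x, y). ln (enn2real (f x y)))"
  defines "c \<equiv> \<lambda>x. \<integral>\<^sup>+y. f x y \<partial>K x"
  shows "integrable (density \<rho> c) (\<lambda>x. ln (enn2real (c x)))"
    and "AE x in density \<rho> c. conditional_density K f x = density (K x) (\<lambda>y. f x y / c x) \<and>
      integrable (conditional_density K f x) (\<lambda>y. ln (enn2real (f x y / c x)))"
proof -
  let ?C = "conditional_density K f"
  let ?P = "density (kernel_product \<rho> N K) (\<lambda>(x, y). f x y)"
  have c[measurable]: "c \<in> borel_measurable M"
    unfolding c_def by (rule measurable_marginal_density[OF K f])
  have s[measurable_cong]: "sets \<rho> = sets M" and \<rho>1: "prob_space \<rho>"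
    using \<rho> by (auto simp: space_prob_algebra)
  have c\<rho>: "c \<in> borel_measurable \<rho>" by measurable
  note C = measurable_conditional_density[OF K f]
  have \<mu>: "density \<rho> c \<in> space (prob_algebra M)" and P_eq: "?P = kernel_product (density \<rho> c) N ?C"
    using density_kernel_product[OF K f \<rho> P] by (simp_all add: c_def)
  then have \<mu>1: "prob_space (density \<rho> c)" by (simp add: space_prob_algebra)
  \<comment> \<open>The conditional mean of the absolute log-density. Its integral is the finite
    norm of the joint log-density, so it is finite almost everywhere.\<close>
  define B where "B x = (\<integral>\<^sup>+y. ennreal \<bar>ln (enn2real (f x y))\<bar> \<partial>?C x)" for x
  have B[measurable]: "B \<in> borel_measurable M"
    unfolding B_def
    by (rule nn_integral_measurable_subprob_algebra2[OF _ measurable_prob_algebraD[OF C]]) measurable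
  have "(\<integral>\<^sup>+x. B x \<partial>density \<rho> c) = (\<integral>\<^sup>+z. ennreal (norm (case z of (x, y) \<Rightarrow> ln (enn2real (f x y)))) \<partial>?P)"
    unfolding P_eq B_def by (subst nn_integral_kernel_product[OF \<mu> C]) simp_all
  also have "\<dots> < \<infinity>" using ln by (simp add: integrable_iff_bounded)
  finally have B_fin: "(\<integral>\<^sup>+x. B x \<partial>density \<rho> c) < \<infinity>" .
  then have AE_B: "AE x in density \<rho> c. B x \<noteq> \<infinity>"
    by (intro nn_integral_PInf_AE) auto
  have AE_c: "AE x in density \<rho> c. 0 < c x \<and> c x < \<infinity>"
    by (rule AE_density_pos_finite[OF c\<rho> \<mu>1])
  have *: "?C x = density (K x) (\<lambda>y. f x y / c x) \<and>
      integrable (?C x) (\<lambda>y. ln (enn2real (f x y / c x))) \<and> ennreal (ln (enn2real (c x))) \<le> B x"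
    if x: "x \<in> space M" and cx: "0 < c x \<and> c x < \<infinity>" and Bx: "B x \<noteq> \<infinity>" for x
  proof -
    let ?h = "\<lambda>y. f x y / c x"
    note measurable_section[OF K f x, measurable]
    have Kx: "prob_space (K x)" using measurable_space[OF K x] by (simp add: space_prob_algebra)
    have Cx: "prob_space (?C x)" using measurable_space[OF C x] by (simp add: space_prob_algebra)
    then interpret Cx: prob_space "?C x" .
    have Ceq: "?C x = density (K x) ?h"
      using cx by (simp add: conditional_density_def c_def)
    have [measurable_cong]: "sets (?C x) = sets (K x)" by (simp add: Ceq)
    have fx: "integrable (?C x) (\<lambda>y. ln (enn2real (f x y)))"
      using Bx by (simp add: integrable_iff_bounded B_def less_top)
    have "AE y in ?C x. 0 < ?h y \<and> ?h y < \<infinity>"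
      using Cx unfolding Ceq by (intro AE_density_pos_finite) auto
    then have ln_h: "AE y in ?C x. ln (enn2real (?h y)) = ln (enn2real (f x y)) - ln (enn2real (c x))"
    proof eventually_elim
      case (elim y)
      obtain a where a: "c x = ennreal a" "a > 0"
        using cx by (cases "c x") (auto simp: ennreal_less_zero_iff)
      obtain b where b: "f x y = ennreal b" "b > 0"
        using elim a by (cases "f x y") (auto simp: ennreal_top_divide divide_ennreal zero_less_divide_iff)
      show ?case using a b by (simp add: divide_ennreal ln_div)
    qed
    have "integrable (?C x) (\<lambda>y. ln (enn2real (?h y)))
        = integrable (?C x) (\<lambda>y. ln (enn2real (f x y)) - ln (enn2real (c x)))"
      using ln_h by (intro integrable_cong_AE) auto
    then have ih: "integrable (?C x) (\<lambda>y. ln (enn2real (?h y)))" using fx by simp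
    have "(\<integral>y. ln (enn2real (?h y)) \<partial>?C x) = (\<integral>y. ln (enn2real (f x y)) - ln (enn2real (c x)) \<partial>?C x)"
      using ln_h by (intro integral_cong_AE) auto
    also have "\<dots> = (\<integral>y. ln (enn2real (f x y)) \<partial>?C x) - ln (enn2real (c x))"
      using fx by (simp add: Cx.prob_space)
    finally have "ln (enn2real (c x)) = (\<integral>y. ln (enn2real (f x y)) \<partial>?C x) - (\<integral>y. ln (enn2real (?h y)) \<partial>?C x)"
      by simp
    \<comment> \<open>Gibbs' inequality against the constant density 1: the conditional entropy
      relative to \<open>K x\<close> is nonnegative.\<close>
    moreover have "0 \<le> (\<integral>y. ln (enn2real (?h y)) \<partial>?C x)"
      using integral_ln_density_le(1)[of ?h "K x" "\<lambda>_. 1"] Kx Cx ih by (simp add: Ceq density_1)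
    ultimately have "ln (enn2real (c x)) \<le> (\<integral>y. \<bar>ln (enn2real (f x y))\<bar> \<partial>?C x)"
      using integral_abs_bound[of "?C x" "\<lambda>y. ln (enn2real (f x y))"] by linarith
    moreover have "ennreal (\<integral>y. \<bar>ln (enn2real (f x y))\<bar> \<partial>?C x) = B x"
      unfolding B_def using fx by (intro nn_integral_eq_integral[symmetric]) auto
    ultimately have "ennreal (ln (enn2real (c x))) \<le> B x"
      by (metis ennreal_leI)
    with Ceq ih show ?thesis by simp
  qed
  have AE: "AE x in density \<rho> c. ?C x = density (K x) (\<lambda>y. f x y / c x) \<and>
      integrable (?C x) (\<lambda>y. ln (enn2real (f x y / c x))) \<and> ennreal (ln (enn2real (c x))) \<le> B x"
    using AE_c AE_B AE_space
  proof eventually_elim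
    case (elim x)
    then show ?case using sets_eq_imp_space_eq[OF s] by (intro *) auto
  qed
  then show "AE x in density \<rho> c. ?C x = density (K x) (\<lambda>y. f x y / c x) \<and>
      integrable (?C x) (\<lambda>y. ln (enn2real (f x y / c x)))"
    by (rule eventually_mono) blast
  show "integrable (density \<rho> c) (\<lambda>x. ln (enn2real (c x)))"
  proof (rule integrableI_bounded)
    \<comment> \<open>\<open>ennreal\<close> truncates negative numbers to 0, so the first summand
      on the right is the negative part of \<open>ln c\<close>, while \<open>B\<close> dominates the
      positive part.\<close>
    have "(\<integral>\<^sup>+x. ennreal (norm (ln (enn2real (c x)))) \<partial>density \<rho> c)
        \<le> (\<integral>\<^sup>+x. ennreal (- ln (enn2real (c x))) + B x \<partial>density \<rho> c)"
    proof (rule nn_integral_mono_AE)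
      from AE show "AE x in density \<rho> c. ennreal (norm (ln (enn2real (c x)))) \<le> ennreal (- ln (enn2real (c x))) + B x"
      proof eventually_elim
        case (elim x)
        show ?case
        proof (cases "ln (enn2real (c x)) \<ge> 0")
          case True
          then show ?thesis using elim by (simp add: add_increasing)
        next
          case False
          then show ?thesis by (simp add: add_increasing2)
        qed
      qed
    qed
    also have "\<dots> = (\<integral>\<^sup>+x. ennreal (- ln (enn2real (c x))) \<partial>density \<rho> c) + (\<integral>\<^sup>+x. B x \<partial>density \<rho> c)"
      by (rule nn_integral_add) measurable
    also have "\<dots> \<le> 1 + (\<integral>\<^sup>+x. B x \<partial>density \<rho> c)"
      by (intro add_right_mono nn_integral_neg_ln_density_le[OF \<rho>1 c\<rho>])
    also have "\<dots> < \<infinity>" using B_fin by (simp add: ennreal_add_eq_top less_top)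
    finally show "(\<integral>\<^sup>+x. ennreal (norm (ln (enn2real (c x)))) \<partial>density \<rho> c) < \<infinity>" .
  qed simp
qed

section \<open>The three endpoint problems\<close>

lemma borel_countably_generated:
  obtains S :: "'a::second_countable_topology set set"
  where "countable S" "S \<subseteq> Pow UNIV" "sets (borel :: 'a measure) = sigma_sets UNIV S"
proof -
  obtain S :: "'a set set" where S: "countable S" "topological_basis S"
    using ex_countable_basis by blast
  then have "sets (borel :: 'a measure) = sigma_sets UNIV S"
    by (subst borel_eq_countable_basis) auto
  with S(1) show thesis by (intro that) auto
qed

lemma conditional_density_compose:
  "conditional_density (\<lambda>x. K (p x)) (\<lambda>x. f (p x)) x = conditional_density K f (p x)"
  by (simp add: conditional_density_def)

context
  fixes s t :: real and I :: "real set"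
    and R :: "((real \<Rightarrow> 'y::euclidean_space) \<times> (real \<Rightarrow> 'x::euclidean_space)) measure"
    and RY :: "(real \<Rightarrow> 'y) measure" and RX :: "'y \<Rightarrow> (real \<Rightarrow> 'x) measure"
    and \<mu> :: "('y \<times> 'x) measure" and \<mu>Y :: "'y measure" and \<mu>X :: "'y \<Rightarrow> 'x measure"
  assumes st: "s < t"
    and I: "I = {s<..t} \<or> I = {s..t}"
    and RX[measurable]: "RX \<in> borel \<rightarrow>\<^sub>M prob_algebra (path_borel I)"
    and R: "is_disintegration (path_borel I) (path_borel I) R RY (\<lambda>\<eta>. RX (\<eta> t))"
    and \<mu>: "is_disintegration borel borel \<mu> \<mu>Y \<mu>X"
    and ac: "absolutely_continuous (distr R borel (endpoints t)) \<mu>"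
    and fin: "relative_entropy \<mu> (distr R borel (endpoints t)) < \<infinity>"
begin

text \<open>Gathers everything the theorem needs about entropy: all three problems have explicit
  solutions, built from one marginal \<open>QY\<close> and one kernel \<open>K\<close>. What remains
  afterwards concerns disintegrations only.\<close>

lemma endpoint_minimisers:
  obtains QY K where
    "QY \<in> space (prob_algebra (path_borel I))"
    "distr QY borel (\<lambda>\<eta>. \<eta> t) = \<mu>Y"
    "K \<in> borel \<rightarrow>\<^sub>M prob_algebra (path_borel I)"
    "\<And>Q. entropy_minimiser (path_borel I \<Otimes>\<^sub>M path_borel I) (endpoints t) R \<mu> Q \<longleftrightarrow>
       Q = kernel_product QY (path_borel I) (\<lambda>\<eta>. K (\<eta> t))"
    "\<And>M. entropy_minimiser (path_borel I) (\<lambda>\<eta>. \<eta> t) RY \<mu>Y M \<longleftrightarrow> M = QY"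
    "AE y in \<mu>Y. \<forall>N. entropy_minimiser (path_borel I) (\<lambda>\<xi>. \<xi> t) (RX y) (\<mu>X y) N \<longleftrightarrow> N = K y"
proof -
  have t: "t \<in> I" using st I by auto
  let ?P = "path_borel I :: (real \<Rightarrow> 'y) measure" and ?P' = "path_borel I :: (real \<Rightarrow> 'x) measure"
  note evy[measurable] = measurable_path_eval[OF t, where 'a='y]
  note evx[measurable] = measurable_path_eval[OF t, where 'a='x]
  have RY: "RY \<in> space (prob_algebra ?P)" and RX': "(\<lambda>\<eta>. RX (\<eta> t)) \<in> ?P \<rightarrow>\<^sub>M prob_algebra ?P'"
    and R_eq: "R = kernel_product RY ?P' (\<lambda>\<eta>. RX (\<eta> t))"
    using R by (auto simp: is_disintegration_def)
  have \<mu>Y: "\<mu>Y \<in> space (prob_algebra borel)" and \<mu>X: "\<mu>X \<in> borel \<rightarrow>\<^sub>M prob_algebra borel"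
    and \<mu>_eq: "\<mu> = kernel_product \<mu>Y borel \<mu>X"
    using \<mu> by (auto simp: is_disintegration_def)
  have R_prob: "R \<in> space (prob_algebra (?P \<Otimes>\<^sub>M ?P'))"
    unfolding R_eq by (rule kernel_product_prob_algebra[OF RY RX'])
  have R1: "prob_space R" and sR[measurable_cong]: "sets R = sets (?P \<Otimes>\<^sub>M ?P')"
    using R_prob by (auto simp: space_prob_algebra)
  have \<mu>1: "prob_space \<mu>" and s\<mu>: "sets \<mu> = sets borel"
    using kernel_product_prob_algebra[OF \<mu>Y \<mu>X] by (auto simp: \<mu>_eq[symmetric] space_prob_algebra borel_prod)
  have ends: "endpoints t = map_prod (\<lambda>\<eta>. \<eta> t) (\<lambda>\<xi>. \<xi> t)"
    by (auto simp: endpoints_def)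
  have ends_meas[measurable]: "endpoints t \<in> ?P \<Otimes>\<^sub>M ?P' \<rightarrow>\<^sub>M borel"
    unfolding ends map_prod_def borel_prod[symmetric] by measurable
  define rY where "rY = distr RY borel (\<lambda>\<eta>. \<eta> t)"
  define rX where "rX y = distr (RX y) borel (\<lambda>\<xi>. \<xi> t)" for y
  define r where "r = distr R borel (endpoints t)"
  have RY1: "prob_space RY" and sRY[measurable_cong]: "sets RY = sets ?P"
    using RY by (auto simp: space_prob_algebra)
  have rY: "rY \<in> space (prob_algebra borel)"
    using RY1 by (auto simp: space_prob_algebra rY_def intro!: prob_space.prob_space_distr)
  have rX[measurable]: "rX \<in> borel \<rightarrow>\<^sub>M prob_algebra borel"
    unfolding rX_def by measurable
  have r_eq: "r = kernel_product rY borel rX"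
    using distr_kernel_product_map_prod[OF RY evy evx RX]
    by (simp add: r_def R_eq ends rY_def rX_def[abs_def] borel_prod)
  have r1: "prob_space r"
    unfolding r_def using R1 by (rule prob_space.prob_space_distr) measurable
  interpret r: prob_space r by fact

  define g where "g = RN_deriv r \<mu>"
  define f where "f y x = g (y, x)" for y x
  have g[measurable]: "g \<in> borel_measurable borel"
    using borel_measurable_RN_deriv[of r \<mu>] by (simp add: g_def r_def)
  have gf: "g = (\<lambda>(y, x). f y x)" by (auto simp: f_def)
  have f[measurable]: "(\<lambda>(y, x). f y x) \<in> borel_measurable (borel \<Otimes>\<^sub>M borel)"
    using g by (simp add: gf borel_prod)
  have \<mu>_dens: "\<mu> = density r g"
    using r.density_RN_deriv[of \<mu>] ac s\<mu> by (simp add: g_def r_def)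
  \<comment> \<open>Finite entropy rules out the infinite branch of
    \<open>relative_entropy_density\<close>.\<close>
  have ln_g: "integrable \<mu> (\<lambda>z. ln (enn2real (g z)))"
  proof (rule ccontr)
    assume "\<not> ?thesis"
    then have "relative_entropy \<mu> r = \<infinity>"
      using relative_entropy_density[OF r1, of g] \<mu>_dens by (simp add: r_def)
    then show False using fin by (simp add: r_def)
  qed
  define c where "c y = (\<integral>\<^sup>+x. f y x \<partial>rX y)" for y
  have c[measurable]: "c \<in> borel_measurable borel"
    unfolding c_def by (rule measurable_marginal_density[OF rX f])
  have \<mu>_f: "\<mu> = density (kernel_product rY borel rX) (\<lambda>(y, x). f y x)"
    by (simp add: \<mu>_dens r_eq gf)
  note \<mu>_prob = \<mu>1[unfolded \<mu>_f]
  have cY: "density rY c \<in> space (prob_algebra borel)"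
    and \<mu>_dis: "\<mu> = kernel_product (density rY c) borel (conditional_density rX f)"
    using density_kernel_product[OF rX f rY \<mu>_prob] by (simp_all add: \<mu>_f c_def[abs_def])
  note C = measurable_conditional_density[OF rX f]
  \<comment> \<open>Both disintegrations of \<open>\<mu>\<close>, the given one and the one from the
    density, have the first marginal of \<open>\<mu>\<close> as their base measure.\<close>
  have \<mu>Y_dens: "\<mu>Y = density rY c"
    using distr_kernel_product_fst[OF \<mu>Y \<mu>X] distr_kernel_product_fst[OF cY C]
    by (simp add: \<mu>_eq[symmetric] \<mu>_dis[symmetric])
  obtain S :: "'x set set" where S: "countable S" "S \<subseteq> Pow UNIV" "sets borel = sigma_sets UNIV S"
    by (rule borel_countably_generated)
  have AE_\<mu>X: "AE y in \<mu>Y. \<mu>X y = conditional_density rX f y"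
    using \<mu>_eq \<mu>_dis by (intro kernel_product_AE_unique[OF S \<mu>Y \<mu>X C]) (simp add: \<mu>Y_dens)
  have "integrable (density (kernel_product rY borel rX) (\<lambda>(y, x). f y x)) (\<lambda>(y, x). ln (enn2real (f y x)))"
  proof -
    have "(\<lambda>(y, x). ln (enn2real (f y x))) = (\<lambda>z. ln (enn2real (g z)))" by (auto simp: f_def)
    then show ?thesis using ln_g by (simp only: \<mu>_f[symmetric])
  qed
  note ln_dis = integrable_ln_disintegration[OF rY rX f \<mu>_prob this, folded c_def, folded \<mu>Y_dens]

  \<comment> \<open>The endpoint densities lifted to paths: \<open>c\<close> for the
    \<open>Y\<close>-path, and \<open>f\<close> normalised against the path law \<open>RX y\<close>
    for the \<open>X\<close>-path.\<close>
  define QY where "QY = density RY (\<lambda>\<eta>. c (\<eta> t))"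
  define K where "K = conditional_density RX (\<lambda>y \<xi>. f y (\<xi> t))"
  have f_ev: "(\<lambda>(y, \<xi>). f y (\<xi> t)) \<in> borel_measurable (borel \<Otimes>\<^sub>M ?P')"
  proof -
    have "(\<lambda>z. (fst z, snd z t)) \<in> borel \<Otimes>\<^sub>M ?P' \<rightarrow>\<^sub>M borel \<Otimes>\<^sub>M borel"
      using evx by measurable
    from measurable_compose[OF this f] show ?thesis by (simp add: case_prod_beta)
  qed
  have K: "K \<in> borel \<rightarrow>\<^sub>M prob_algebra ?P'"
    unfolding K_def by (rule measurable_conditional_density[OF RX f_ev])
  \<comment> \<open>The density sees a path only at \<open>t\<close>, so path laws and endpoint laws
    have the same normalising constant.\<close>
  have c_path: "c y = (\<integral>\<^sup>+\<xi>. f y (\<xi> t) \<partial>RX y)" for y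
  proof -
    have "sets (RX y) = sets ?P'"
      using subprob_measurableD(2)[OF measurable_prob_algebraD[OF RX]] by simp
    then have "(\<lambda>\<xi>. \<xi> t) \<in> RX y \<rightarrow>\<^sub>M borel" using evx measurable_cong_sets by blast
    moreover have "f y \<in> borel_measurable borel" using measurable_Pair2[OF f, of y] by simp
    ultimately show ?thesis by (simp add: c_def rX_def nn_integral_distr)
  qed
  have distr_QY: "distr QY borel (\<lambda>\<eta>. \<eta> t) = \<mu>Y"
    unfolding QY_def \<mu>Y_dens rY_def by (rule density_distr[symmetric]) measurable

  let ?f = "\<lambda>\<eta> \<xi>. f (\<eta> t) (\<xi> t)"
  have f_path: "(\<lambda>(\<eta>, \<xi>). ?f \<eta> \<xi>) \<in> borel_measurable (?P \<Otimes>\<^sub>M ?P')"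
    using measurable_compose[OF ends_meas g] by (simp add: endpoints_def f_def case_prod_beta)
  have g_path: "(\<lambda>z. g (endpoints t z)) = (\<lambda>(\<eta>, \<xi>). ?f \<eta> \<xi>)"
    by (auto simp: endpoints_def f_def)
  have "distr (density R (\<lambda>z. g (endpoints t z))) borel (endpoints t) = \<mu>"
    unfolding \<mu>_dens r_def by (rule density_distr[symmetric]) measurable
  then have "prob_space (density R (\<lambda>z. g (endpoints t z)))"
    using \<mu>1 by (intro prob_space_distrD[of "endpoints t" _ borel]) simp_all
  then have Q1: "prob_space (density (kernel_product RY ?P' (\<lambda>\<eta>. RX (\<eta> t))) (\<lambda>(\<eta>, \<xi>). ?f \<eta> \<xi>))"
    unfolding g_path R_eq .
  \<comment> \<open>The joint minimiser is disintegrated at path level. Its kernel depends on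
    \<open>\<eta>\<close> only through \<open>\<eta> t\<close> because both \<open>RX\<close> and
    the density do.\<close>
  have QY: "QY \<in> space (prob_algebra ?P)"
    and Q_dis: "density R (\<lambda>z. g (endpoints t z)) = kernel_product QY ?P' (\<lambda>\<eta>. K (\<eta> t))"
    using density_kernel_product[OF RX' f_path RY Q1]
    unfolding c_path[symmetric] QY_def[symmetric] R_eq[symmetric] g_path[symmetric]
    by (simp_all add: K_def conditional_density_compose[of RX "\<lambda>\<eta>. \<eta> t" "\<lambda>y \<xi>. f y (\<xi> t)", abs_def])
  show thesis
  proof (rule that[OF QY distr_QY K])
    show "entropy_minimiser (?P \<Otimes>\<^sub>M ?P') (endpoints t) R \<mu> Q \<longleftrightarrow>
       Q = kernel_product QY ?P' (\<lambda>\<eta>. K (\<eta> t))" for Q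
      using entropy_minimiser_iff_density[OF R_prob ends_meas g _ \<mu>1 ln_g] \<mu>_dens
      by (simp add: r_def Q_dis)
    have \<mu>Y1: "prob_space \<mu>Y" using \<mu>Y by (simp add: space_prob_algebra)
    show "entropy_minimiser ?P (\<lambda>\<eta>. \<eta> t) RY \<mu>Y M \<longleftrightarrow> M = QY" for M
      using entropy_minimiser_iff_density[OF RY evy c _ \<mu>Y1 ln_dis(1)] \<mu>Y_dens
      by (simp add: rY_def QY_def)
    \<comment> \<open>For these \<open>y\<close> the normalisation is genuine, so neither
      \<open>conditional_density rX f y\<close> nor \<open>K y\<close> is the fallback.\<close>
    have "AE y in \<mu>Y. 0 < c y \<and> c y < \<infinity>"
      using \<mu>Y1 rY unfolding \<mu>Y_dens
      by (intro AE_density_pos_finite) (simp_all add: rY_def)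
    with AE_\<mu>X ln_dis(2)
    show "AE y in \<mu>Y. \<forall>N. entropy_minimiser ?P' (\<lambda>\<xi>. \<xi> t) (RX y) (\<mu>X y) N \<longleftrightarrow> N = K y"
    proof eventually_elim
      case (elim y)
      have RXy: "RX y \<in> space (prob_algebra ?P')" using measurable_space[OF RX] by simp
      have h: "(\<lambda>x. f y x / c y) \<in> borel_measurable borel"
        using measurable_Pair2[OF f, of y] by simp
      have \<mu>Xy: "\<mu>X y = density (distr (RX y) borel (\<lambda>\<xi>. \<xi> t)) (\<lambda>x. f y x / c y)"
        using elim by (simp add: rX_def)
      have \<mu>X1: "prob_space (\<mu>X y)" using measurable_space[OF \<mu>X] by (simp add: space_prob_algebra)
      have "\<mu>X y = conditional_density rX f y" using elim by blast
      moreover have "integrable (conditional_density rX f y) (\<lambda>x. ln (enn2real (f y x / c y)))"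
        using elim by blast
      ultimately have "integrable (\<mu>X y) (\<lambda>x. ln (enn2real (f y x / c y)))" by (simp only:)
      note iff = entropy_minimiser_iff_density[OF RXy evx h \<mu>Xy \<mu>X1 this]
      have "K y = density (RX y) (\<lambda>\<xi>. f y (\<xi> t) / c y)"
        using elim by (simp add: K_def conditional_density_def c_path)
      then show ?case by (simp add: iff)
    qed
  qed
qed

end

section \<open>Characterisation of the joint minimiser by its marginal and conditional laws\<close>

theorem proposition3:
  fixes s t :: real and I :: "real set"
    and R Q :: "((real \<Rightarrow> 'y::euclidean_space) \<times> (real \<Rightarrow> 'x::euclidean_space)) measure"
    and RY :: "(real \<Rightarrow> 'y) measure" and RX :: "'y \<Rightarrow> (real \<Rightarrow> 'x) measure"
    and \<mu> :: "('y \<times> 'x) measure" and \<mu>Y :: "'y measure" and \<mu>X :: "'y \<Rightarrow> 'x measure"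
  assumes "s < t"
    and "I = {s<..t} \<or> I = {s..t}"
    and "RX \<in> borel \<rightarrow>\<^sub>M prob_algebra (path_borel I)"
    and "is_disintegration (path_borel I) (path_borel I) R RY (\<lambda>\<eta>. RX (\<eta> t))"
    and "is_disintegration borel borel \<mu> \<mu>Y \<mu>X"
    and "absolutely_continuous (distr R borel (endpoints t)) \<mu>"
    and "relative_entropy \<mu> (distr R borel (endpoints t)) < \<infinity>"
    and "Q \<in> space (prob_algebra (path_borel I \<Otimes>\<^sub>M path_borel I))"
    and "distr Q borel (endpoints t) = \<mu>"
  shows "(AE y in \<mu>Y. \<exists>!N. entropy_minimiser (path_borel I) (\<lambda>\<xi>. \<xi> t) (RX y) (\<mu>X y) N) \<and>
    (entropy_minimiser (path_borel I \<Otimes>\<^sub>M path_borel I) (endpoints t) R \<mu> Q \<longleftrightarrow>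
       entropy_minimiser (path_borel I) (\<lambda>\<eta>. \<eta> t) RY \<mu>Y (distr Q (path_borel I) fst) \<and>
       (\<exists>QX. is_disintegration (path_borel I) (path_borel I) Q (distr Q (path_borel I) fst) QX) \<and>
       (\<forall>QX. is_disintegration (path_borel I) (path_borel I) Q (distr Q (path_borel I) fst) QX \<longrightarrow>
         (AE \<eta> in distr Q (path_borel I) fst.
            QX \<eta> = (THE N. entropy_minimiser (path_borel I) (\<lambda>\<xi>. \<xi> t) (RX (\<eta> t)) (\<mu>X (\<eta> t)) N))))"
    (is "?unique \<and> (?min \<longleftrightarrow> ?minY \<and> ?ex \<and> ?all)")
proof -
  let ?P = "path_borel I :: (real \<Rightarrow> 'y) measure" and ?P' = "path_borel I :: (real \<Rightarrow> 'x) measure"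
  obtain QY K where QY: "QY \<in> space (prob_algebra ?P)" "distr QY borel (\<lambda>\<eta>. \<eta> t) = \<mu>Y"
    and K: "K \<in> borel \<rightarrow>\<^sub>M prob_algebra ?P'"
    and min: "\<And>Q. entropy_minimiser (?P \<Otimes>\<^sub>M ?P') (endpoints t) R \<mu> Q \<longleftrightarrow>
       Q = kernel_product QY ?P' (\<lambda>\<eta>. K (\<eta> t))"
    and minY: "\<And>M. entropy_minimiser ?P (\<lambda>\<eta>. \<eta> t) RY \<mu>Y M \<longleftrightarrow> M = QY"
    and minX: "AE y in \<mu>Y. \<forall>N. entropy_minimiser ?P' (\<lambda>\<xi>. \<xi> t) (RX y) (\<mu>X y) N \<longleftrightarrow> N = K y"
    by (rule endpoint_minimisers[OF assms(1-7)]) (rule that)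
  have "t \<in> I" using assms(1,2) by auto
  note evy[measurable] = measurable_path_eval[OF this, where 'a='y]
  have Kt: "(\<lambda>\<eta>. K (\<eta> t)) \<in> ?P \<rightarrow>\<^sub>M prob_algebra ?P'"
    using evy K by (rule measurable_compose)
  have sQY: "sets QY = sets ?P" using QY by (simp add: space_prob_algebra)
  \<comment> \<open>Where the conditional minimiser is unique, \<open>THE\<close> denotes it. The
    statement for almost every endpoint lifts to almost every path, as \<open>\<mu>Y\<close> is the
    endpoint law of \<open>QY\<close>.\<close>
  have "AE y in distr QY borel (\<lambda>\<eta>. \<eta> t). (THE N. entropy_minimiser ?P' (\<lambda>\<xi>. \<xi> t) (RX y) (\<mu>X y) N) = K y"
    unfolding QY(2) using minX by eventually_elim simp
  then have the: "AE \<eta> in QY. (THE N. entropy_minimiser ?P' (\<lambda>\<xi>. \<xi> t) (RX (\<eta> t)) (\<mu>X (\<eta> t)) N) = K (\<eta> t)"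
    by (rule AE_distrD[rotated]) (simp add: measurable_cong_sets[OF sQY refl])
  obtain S :: "(real \<Rightarrow> 'x) set set"
    where S: "countable S" "S \<subseteq> Pow (paths I)" "sets (path_borel I) = sigma_sets (paths I) S"
    using path_borel_countably_generated[OF assms(2)] by blast
  have ?unique using minX by eventually_elim simp
  moreover have "?minY \<and> ?ex \<and> ?all" if ?min
  proof -
    from that min have Q: "Q = kernel_product QY ?P' (\<lambda>\<eta>. K (\<eta> t))" by blast
    then have fst: "distr Q ?P fst = QY" using distr_kernel_product_fst[OF QY(1) Kt] by simp
    have "AE \<eta> in QY. QX \<eta> = (THE N. entropy_minimiser ?P' (\<lambda>\<xi>. \<xi> t) (RX (\<eta> t)) (\<mu>X (\<eta> t)) N)"
      if "is_disintegration ?P ?P' Q QY QX" for QX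
    proof -
      from that have QX: "QX \<in> ?P \<rightarrow>\<^sub>M prob_algebra ?P'" "Q = kernel_product QY ?P' QX"
        by (auto simp: is_disintegration_def)
      \<comment> \<open>Any disintegration of \<open>Q\<close> agrees almost surely with the
        explicit one, by countable generation of the \<open>X\<close>-path space.\<close>
      have "AE \<eta> in QY. QX \<eta> = K (\<eta> t)"
        using Q QX(2) by (intro kernel_product_AE_unique[OF S QY(1) QX(1) Kt]) simp
      with the show ?thesis by eventually_elim simp
    qed
    moreover have "is_disintegration ?P ?P' Q QY (\<lambda>\<eta>. K (\<eta> t))"
      using QY Kt Q by (simp add: is_disintegration_def)
    ultimately show ?thesis using minY fst by auto
  qed
  moreover have ?min if "?minY \<and> ?ex \<and> ?all"
  proof -
    from that minY have fst: "distr Q ?P fst = QY" by blast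
    \<comment> \<open>The existence clause supplies a disintegration to which the almost sure
      identity can be applied; replacing its kernel by \<open>K (\<eta> t)\<close> on a set of full
      measure leaves \<open>Q\<close> unchanged.\<close>
    with that obtain QX where dis: "is_disintegration ?P ?P' Q QY QX" by auto
    with that fst have "AE \<eta> in QY. QX \<eta> = (THE N. entropy_minimiser ?P' (\<lambda>\<xi>. \<xi> t) (RX (\<eta> t)) (\<mu>X (\<eta> t)) N)"
      by auto
    with the have eq: "AE \<eta> in QY. QX \<eta> = K (\<eta> t)" by eventually_elim simp
    from dis have "QX \<in> ?P \<rightarrow>\<^sub>M prob_algebra ?P'" and Q: "Q = kernel_product QY ?P' QX"
      by (auto simp: is_disintegration_def)
    from kernel_product_cong_AE[OF QY(1) this(1) Kt eq] show ?thesis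
      unfolding min Q .
  qed
  ultimately show ?thesis by blast
qed

end
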